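(* Let $X\neq\{0\}$ be a complex Banach space and let $\varphi\in\mathcal{OM}_-$ with representing measure $\mu$. The following statements are equivalent: 1) $\varphi$ is operator Lipschitz in any class $\mathcal{NP}_c(X):=\{A\in\mathcal{NP}(X):M_A\le c\}$, $c=\mathrm{const}$; i.e. for every constant $c$ there is a constant $L$ such that $\|\varphi(A)-\varphi(B)\|\le L\|A-B\|$ for all $A,B\in\mathcal{NP}_c(X)$ such that $D(A)\subseteq D(B)$ and $A-B$ is bounded; 2) $\varphi'(-0)\neq\infty$; 3) $\int_{(0,\infty)}\frac{d\mu(t)}{t}<\infty$; 4) there is a constant $L_1$ such that $|\varphi(x)|\le L_1|x|$ for all $x\in(-\infty,0]$; 5) $\varphi$ is Lipschitz on $(-\infty,0]$.
   Context: A closed densely defined operator $A$ on $X$ is nonpositive, $A\in\mathcal{NP}(X)$, if $(0,\infty)\subset\rho(A)$ and $M_A:=\sup_{t>0}\|tR(t,A)\|<\infty$, where $R(t,A)=(tI-A)^{-1}$. $\mathcal{OM}_-$ denotes the class of negative complete Bernstein functions, normalized to have no affine part, i.e. the functions $\varphi(z)=\int_{(0,\infty)}\frac{z}{t-z}\,d\mu(t)$, $z\in\mathbb{C}\setminus(0,\infty)$, where $\mu$ is a (unique) positive measure on $(0,\infty)$ with $\int_{(0,\infty)}\frac{d\mu(t)}{1+t}<\infty$. Put $\varphi'(-0)=\lim_{s\to0,\,s<0}\varphi'(s)\in[0,\infty]$. For $A\in\mathcal{NP}(X)$, $\varphi(A)$ is the closure of the operator $x\mapsto\int_{(0,\infty)}AR(t,A)x\,d\mu(t)$,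 $x\in D(A)$. If $D(A)\subseteq D(B)$, the differences $A-B$ and $\varphi(A)-\varphi(B)$ are considered on the dense subspace $D(A)$; when bounded there they are identified with their bounded extensions to $X$. *)

theory Defs
  imports "HOL-Analysis.Analysis"
begin

class complex_normed_vector = real_normed_vector +
  fixes scaleC :: "complex \<Rightarrow> 'a \<Rightarrow> 'a"  (infixr \<open>*\<^sub>C\<close> 75)
  assumes scaleC_add_right: "c *\<^sub>C (x + y) = c *\<^sub>C x + c *\<^sub>C y"
    and scaleC_add_left: "(c + d) *\<^sub>C x = c *\<^sub>C x + d *\<^sub>C x"
    and scaleC_scaleC: "c *\<^sub>C d *\<^sub>C x = (c * d) *\<^sub>C x"
    and scaleC_of_real: "complex_of_real r *\<^sub>C x = r *\<^sub>R x"
    and norm_scaleC: "norm (c *\<^sub>C x) = cmod c * norm x"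

class complex_banach = complex_normed_vector + banach

instantiation complex :: complex_banach
begin

definition scaleC_complex :: "complex \<Rightarrow> complex \<Rightarrow> complex" where
  "scaleC_complex c x = c * x"

instance
  by standard (simp_all add: scaleC_complex_def algebra_simps norm_mult scaleR_conv_of_real)

end

definition bounded_clinear :: "('a::complex_normed_vector \<Rightarrow> 'b::complex_normed_vector) \<Rightarrow> bool" where
  "bounded_clinear f \<longleftrightarrow> bounded_linear f \<and> (\<forall>c x. f (c *\<^sub>C x) = c *\<^sub>C f x)"

text \<open>The library's Bochner integral is restricted to second countable codomains, i.e. to separable
  Banach spaces. The following has the same clauses as \<^verbatim>\<open>has_bochner_integral\<close>, without this
  restriction. (Approximability in mean by simple functions forces f to be almost everywhere
  separably valued.)\<close>

definition has_Bochner_int ::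
    "'s measure \<Rightarrow> ('s \<Rightarrow> 'a) \<Rightarrow> 'a::real_normed_vector \<Rightarrow> bool" where
  "has_Bochner_int M f y \<longleftrightarrow> f \<in> borel_measurable M \<and>
     (\<exists>s. (\<forall>i::nat. Bochner_Integration.simple_bochner_integrable M (s i)) \<and>
          (\<lambda>i. \<integral>\<^sup>+t. ennreal (norm (f t - s i t)) \<partial>M) \<longlonglongrightarrow> 0 \<and>
          (\<lambda>i. Bochner_Integration.simple_bochner_integral M (s i)) \<longlonglongrightarrow> y)"

text \<open>A partially defined operator is represented by its graph; its domain is the \<^const>\<open>Domain\<close> of
  the graph, it is closed iff the graph is closed in the product space, and its closure is the
  closure of the graph.\<close>

definition linear_operator :: "'a::complex_normed_vector rel \<Rightarrow> bool" where
  "linear_operator A \<longleftrightarrow> single_valued A \<and> (0, 0) \<in> A \<and>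
     (\<forall>x y u v. (x, u) \<in> A \<longrightarrow> (y, v) \<in> A \<longrightarrow> (x + y, u + v) \<in> A) \<and>
     (\<forall>c x u. (x, u) \<in> A \<longrightarrow> (c *\<^sub>C x, c *\<^sub>C u) \<in> A)"

definition op_apply :: "'a rel \<Rightarrow> 'a \<Rightarrow> 'a" where
  "op_apply A x = (THE y. (x, y) \<in> A)"

definition resolvent :: "complex \<Rightarrow> 'a::complex_normed_vector rel \<Rightarrow> 'a \<Rightarrow> 'a" where
  "resolvent z A = inv_into (Domain A) (\<lambda>x. z *\<^sub>C x - op_apply A x)"

definition resolvent_set :: "'a::complex_normed_vector rel \<Rightarrow> complex set" where
  "resolvent_set A = {z. bij_betw (\<lambda>x. z *\<^sub>C x - op_apply A x) (Domain A) UNIV \<and>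
                         bounded_clinear (resolvent z A)}"

definition nonpos_const :: "'a::complex_normed_vector rel \<Rightarrow> ereal" where
  "nonpos_const A = (SUP t\<in>{0::real<..}. ereal (onorm (\<lambda>x. t *\<^sub>R resolvent (complex_of_real t) A x)))"

definition NP :: "'a::complex_banach rel set" where
  "NP = {A. linear_operator A \<and> closed A \<and> closure (Domain A) = UNIV \<and>
            complex_of_real ` {0<..} \<subseteq> resolvent_set A \<and> nonpos_const A < \<infinity>}"

definition NP_le :: "real \<Rightarrow> 'a::complex_banach rel set" where
  "NP_le c = {A \<in> NP. nonpos_const A \<le> ereal c}"

definition op_diff :: "'a rel \<Rightarrow> 'a rel \<Rightarrow> 'a::ab_group_add \<Rightarrow> 'a" where
  "op_diff A B x = op_apply A x - op_apply B x"

definition bounded_op_on :: "'a::real_normed_vector set \<Rightarrow> ('a \<Rightarrow> 'a) \<Rightarrow> bool" where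
  "bounded_op_on D F \<longleftrightarrow> (\<exists>K. \<forall>x\<in>D. norm (F x) \<le> K * norm x)"

text \<open>Meaningful if D is a dense subspace on which F is linear and bounded.\<close>

definition bounded_ext :: "'a::complex_normed_vector set \<Rightarrow> ('a \<Rightarrow> 'a) \<Rightarrow> 'a \<Rightarrow> 'a" where
  "bounded_ext D F = (THE S. bounded_clinear S \<and> (\<forall>x\<in>D. S x = F x))"

text \<open>The measure lives on the space of positive reals. The values of the function on the
  positive half-axis are irrelevant and left unspecified.\<close>

definition OM_minus_rep :: "(complex \<Rightarrow> complex) \<Rightarrow> real measure \<Rightarrow> bool" where
  "OM_minus_rep \<phi> \<mu> \<longleftrightarrow>
     sets \<mu> = sets (restrict_space borel {0<..}) \<and>
     (\<integral>\<^sup>+t. ennreal (1 / (1 + t)) \<partial>\<mu>) < \<infinity> \<and>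
     (\<forall>z. z \<notin> complex_of_real ` {0<..} \<longrightarrow> \<phi> z = (\<integral>t. z / (complex_of_real t - z) \<partial>\<mu>))"

text \<open>On the negative half-axis, which lies in the interior of the domain of \<open>\<phi>\<close>, the complex
  derivative is real; \<^const>\<open>Re\<close> is only a coercion.\<close>

definition deriv_minus_zero :: "(complex \<Rightarrow> complex) \<Rightarrow> ereal" where
  "deriv_minus_zero \<phi> = Lim (at_left (0::real)) (\<lambda>s. ereal (Re (deriv \<phi> (complex_of_real s))))"

text \<open>This is \<open>\<phi>(A)\<close>, where \<open>\<mu>\<close> is the representing measure of \<open>\<phi>\<close>.\<close>

definition op_calc :: "real measure \<Rightarrow> 'a::complex_banach rel \<Rightarrow> 'a rel" where
  "op_calc \<mu> A = closure {(x, y). x \<in> Domain A \<and>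
     has_Bochner_int \<mu> (\<lambda>t. op_apply A (resolvent (complex_of_real t) A x)) y}"

text \<open>The function enters through its representing measure. The boundedness of the difference of the
  function values, needed for its norm to be defined, is part of the claim.\<close>

definition op_Lipschitz_NP :: "real measure \<Rightarrow> 'a::complex_banach itself \<Rightarrow> bool" where
  "op_Lipschitz_NP \<mu> X \<longleftrightarrow>
     (\<forall>c::real. \<exists>L::real. \<forall>A \<in> (NP_le c :: 'a rel set). \<forall>B \<in> NP_le c.
        Domain A \<subseteq> Domain B \<and> bounded_op_on (Domain A) (op_diff A B) \<longrightarrow>
        bounded_op_on (Domain A) (op_diff (op_calc \<mu> A) (op_calc \<mu> B)) \<and>
        onorm (bounded_ext (Domain A) (op_diff (op_calc \<mu> A) (op_calc \<mu> B)))
          \<le> L * onorm (bounded_ext (Domain A) (op_diff A B)))"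

end

theory Submission
  imports Defs
begin

text \<open>Everything reduces to finiteness of \<open>\<integral> 1/t d\<mu>\<close>. If it is finite, then
  \<open>A R(t,A) - B R(t,B) = t R(t,B) (A - B) R(t,A)\<close> has norm at most \<open>c\<^sup>2 \<parallel>A - B\<parallel> / t\<close>, which integrates
  to the operator Lipschitz estimate. Conversely, operator Lipschitz continuity, applied to a
  nonpositive scalar operator \<open>x I\<close> and to \<open>0\<close>, gives \<open>\<bar>\<phi>(x)\<bar> \<le> L \<bar>x\<bar>\<close>, that is
  \<open>\<integral> 1/(t - x) d\<mu> \<le> L\<close>, and monotone convergence as \<open>x\<close> increases to \<open>0\<close> bounds \<open>\<integral> 1/t d\<mu>\<close>. The
  same limit, applied to \<open>\<phi>'(x) = \<integral> t/(t - x)\<^sup>2 d\<mu>\<close>, identifies \<open>\<phi>'(-0)\<close> with \<open>\<integral> 1/t d\<mu>\<close>.\<close>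

section \<open>Bochner integrals in nonseparable Banach spaces\<close>

text \<open>The analysis behind both directions is short; the definitions create the obstacles.
  \<open>op_calc\<close> is the closure of a graph, so nothing can be said about \<phi>(A) x for x
  in D(A) until the closure is known to add no second value over D(A). The norms are those of
  extensions selected by \<open>THE\<close>, so an extension has to be constructed and shown to be
  unique. The space may be nonseparable, where Borel measurability does not pass to sums, so
  additivity of the integral is not automatic. The factorization of the difference rests on A R(t,A)
  = t R(t,A) - I: the identity terms cancel, and what remains is t (R(t,A) - R(t,B)). Each resolvent
  contributes a factor c/t, and the factor t in front leaves a single 1/t.\<close>

lemma simple_bochner_integral_norm_le_nn_integral:
  fixes s :: "'s \<Rightarrow> 'a::real_normed_vector"
  assumes s: "Bochner_Integration.simple_bochner_integrable M s"
  shows "ennreal (norm (Bochner_Integration.simple_bochner_integral M s)) \<le> (\<integral>\<^sup>+x. norm (s x) \<partial>M)"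
proof -
  have n: "Bochner_Integration.simple_bochner_integrable M (\<lambda>x. norm (s x))"
    using simple_bochner_integrable_compose2[of "\<lambda>x y. norm x", OF _ s s] by simp
  have "ennreal (norm (Bochner_Integration.simple_bochner_integral M s)) \<le> Bochner_Integration.simple_bochner_integral M (\<lambda>x. norm (s x))"
    by (intro ennreal_leI simple_bochner_integral_norm_bound s)
  also have "\<dots> = (\<integral>\<^sup>+x. norm (s x) \<partial>M)"
    using n by (intro simple_bochner_integral_eq_nn_integral) auto
  finally show ?thesis .
qed

text \<open>Without second countability, differences of measurable functions need not be measurable;
  here finiteness of the range of s is used instead.\<close>

lemma measurable_norm_diff_simple:
  fixes f :: "'s \<Rightarrow> 'a::real_normed_vector"
  assumes f: "f \<in> borel_measurable M" and s: "Bochner_Integration.simple_bochner_integrable M s"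
  shows "(\<lambda>x. norm (f x - s x)) \<in> borel_measurable M"
proof -
  have sf: "simple_function M s"
    using s by (auto elim: simple_bochner_integrable.cases)
  have sm[measurable]: "s \<in> measurable M (count_space UNIV)"
    using sf by (rule measurable_simple_function)
  have [measurable]: "(\<lambda>x. norm (f x - v)) \<in> borel_measurable M" for v
  proof (rule measurable_compose[OF f])
    show "(\<lambda>y. norm (y - v)) \<in> borel_measurable borel"
      by (intro borel_measurable_continuous_onI continuous_intros)
  qed
  have fin: "finite (s ` space M)"
    using sf by (simp add: simple_function_def)
  have "(\<lambda>x. \<Sum>v\<in>s ` space M. if s x = v then norm (f x - v) else 0) \<in> borel_measurable M"
    by measurable
  also have "?this \<longleftrightarrow> ?thesis"
    using fin by (intro measurable_cong) simp
  finally show ?thesis .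
qed

text \<open>The function \<open>f\<close> is an intermediary in the triangle inequality: it turns
  convergence in mean to \<open>f\<close> into the Cauchy property of the integrals of the
  approximants. With the zero function as one of the two simple functions it becomes a norm
  estimate.\<close>

lemma simple_bochner_integral_dist_le:
  fixes f :: "'s \<Rightarrow> 'a::real_normed_vector"
  assumes f: "f \<in> borel_measurable M"
    and s: "Bochner_Integration.simple_bochner_integrable M s" and t: "Bochner_Integration.simple_bochner_integrable M t"
  shows "ennreal (dist (Bochner_Integration.simple_bochner_integral M s) (Bochner_Integration.simple_bochner_integral M t)) \<le>
    (\<integral>\<^sup>+x. norm (f x - s x) \<partial>M) + (\<integral>\<^sup>+x. norm (f x - t x) \<partial>M)"
proof -
  note [measurable] = measurable_norm_diff_simple[OF f s] measurable_norm_diff_simple[OF f t]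
  have "ennreal (dist (Bochner_Integration.simple_bochner_integral M s) (Bochner_Integration.simple_bochner_integral M t))
      \<le> (\<integral>\<^sup>+x. norm (s x - t x) \<partial>M)"
    using simple_bochner_integral_norm_le_nn_integral[OF simple_bochner_integrable_compose2[of "(-)", OF _ s t]]
    by (simp add: dist_norm simple_bochner_integral_diff s t)
  also have "\<dots> \<le> (\<integral>\<^sup>+x. ennreal (norm (f x - s x)) + ennreal (norm (f x - t x)) \<partial>M)"
    by (intro nn_integral_mono)
       (metis ennreal_leI ennreal_plus norm_ge_zero norm_minus_commute norm_triangle_ineq diff_add_cancel add_diff_eq)
  also have "\<dots> = (\<integral>\<^sup>+x. norm (f x - s x) \<partial>M) + (\<integral>\<^sup>+x. norm (f x - t x) \<partial>M)"
    by (intro nn_integral_add) auto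
  finally show ?thesis .
qed

lemma has_Bochner_int_cong:
  assumes "\<And>x. x \<in> space M \<Longrightarrow> f x = g x"
  shows "has_Bochner_int M f y \<longleftrightarrow> has_Bochner_int M g y"
  using assms unfolding has_Bochner_int_def
  by (simp cong: measurable_cong nn_integral_cong)

lemma has_Bochner_int_norm_le:
  fixes f :: "'s \<Rightarrow> 'a::real_normed_vector"
  assumes "has_Bochner_int M f y"
  shows "ennreal (norm y) \<le> (\<integral>\<^sup>+x. norm (f x) \<partial>M)"
proof -
  from assms obtain s where f: "f \<in> borel_measurable M"
    and s: "\<And>i::nat. Bochner_Integration.simple_bochner_integrable M (s i)"
    and 1: "(\<lambda>i. \<integral>\<^sup>+t. ennreal (norm (f t - s i t)) \<partial>M) \<longlonglongrightarrow> 0"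
    and 2: "(\<lambda>i. Bochner_Integration.simple_bochner_integral M (s i)) \<longlonglongrightarrow> y"
    unfolding has_Bochner_int_def by blast
  have z: "Bochner_Integration.simple_bochner_integrable M (\<lambda>_. 0::'a)"
    by (intro simple_bochner_integrable.intros) auto
  have z0: "Bochner_Integration.simple_bochner_integral M (\<lambda>_. 0::'a) = 0"
    by (simp add: simple_bochner_integral_def image_constant_conv)
  have "ennreal (norm (Bochner_Integration.simple_bochner_integral M (s i)))
      \<le> (\<integral>\<^sup>+t. norm (f t - s i t) \<partial>M) + (\<integral>\<^sup>+t. norm (f t) \<partial>M)" for i
    using simple_bochner_integral_dist_le[OF f s z] by (simp add: z0)
  moreover have "(\<lambda>i. (\<integral>\<^sup>+t. norm (f t - s i t) \<partial>M) + (\<integral>\<^sup>+t. norm (f t) \<partial>M)) \<longlonglongrightarrow>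
      0 + (\<integral>\<^sup>+t. norm (f t) \<partial>M)"
    by (intro tendsto_add 1 tendsto_const)
  moreover have "(\<lambda>i. ennreal (norm (Bochner_Integration.simple_bochner_integral M (s i)))) \<longlonglongrightarrow> ennreal (norm y)"
    by (intro tendsto_ennrealI tendsto_norm 2)
  ultimately show ?thesis
    by (auto intro: LIMSEQ_le)
qed

text \<open>The approximating simple functions can be added, but this does not make the sum Borel
  measurable, hence \<open>meas\<close>. In the applications the integrands depend continuously on t
  > 0, and continuity is preserved by sums.\<close>

lemma has_Bochner_int_add:
  fixes f g :: "'s \<Rightarrow> 'a::real_normed_vector"
  assumes "has_Bochner_int M f y" "has_Bochner_int M g z"
    and meas: "(\<lambda>x. f x + g x) \<in> borel_measurable M"
  shows "has_Bochner_int M (\<lambda>x. f x + g x) (y + z)"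
proof -
  from assms(1) obtain s where f: "f \<in> borel_measurable M"
    and s: "\<And>i::nat. Bochner_Integration.simple_bochner_integrable M (s i)"
    and s1: "(\<lambda>i. \<integral>\<^sup>+t. ennreal (norm (f t - s i t)) \<partial>M) \<longlonglongrightarrow> 0"
    and s2: "(\<lambda>i. Bochner_Integration.simple_bochner_integral M (s i)) \<longlonglongrightarrow> y"
    unfolding has_Bochner_int_def by blast
  from assms(2) obtain r where g: "g \<in> borel_measurable M"
    and r: "\<And>i::nat. Bochner_Integration.simple_bochner_integrable M (r i)"
    and r1: "(\<lambda>i. \<integral>\<^sup>+t. ennreal (norm (g t - r i t)) \<partial>M) \<longlonglongrightarrow> 0"
    and r2: "(\<lambda>i. Bochner_Integration.simple_bochner_integral M (r i)) \<longlonglongrightarrow> z"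
    unfolding has_Bochner_int_def by blast
  note [measurable] = measurable_norm_diff_simple[OF f s] measurable_norm_diff_simple[OF g r]
  show ?thesis
    unfolding has_Bochner_int_def
  proof (intro conjI exI allI)
    show "Bochner_Integration.simple_bochner_integrable M (\<lambda>x. s i x + r i x)" for i
      by (rule simple_bochner_integrable_compose2[OF _ s r]) simp
    show "(\<lambda>i. Bochner_Integration.simple_bochner_integral M (\<lambda>x. s i x + r i x)) \<longlonglongrightarrow> y + z"
      by (simp add: simple_bochner_integral_add s r tendsto_add s2 r2)
    have le: "(\<integral>\<^sup>+t. norm (f t + g t - (s i t + r i t)) \<partial>M) \<le>
        (\<integral>\<^sup>+t. norm (f t - s i t) \<partial>M) + (\<integral>\<^sup>+t. norm (g t - r i t) \<partial>M)" for i
    proof -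
      have "(\<integral>\<^sup>+t. norm (f t + g t - (s i t + r i t)) \<partial>M) \<le>
          (\<integral>\<^sup>+t. ennreal (norm (f t - s i t)) + ennreal (norm (g t - r i t)) \<partial>M)"
        by (intro nn_integral_mono) (auto intro!: norm_diff_triangle_ineq simp flip: ennreal_plus)
      also have "\<dots> = (\<integral>\<^sup>+t. norm (f t - s i t) \<partial>M) + (\<integral>\<^sup>+t. norm (g t - r i t) \<partial>M)"
        by (intro nn_integral_add) auto
      finally show ?thesis .
    qed
    show "(\<lambda>i. \<integral>\<^sup>+t. norm (f t + g t - (s i t + r i t)) \<partial>M) \<longlonglongrightarrow> 0"
      by (rule tendsto_sandwich[OF _ _ tendsto_const tendsto_add[OF s1 r1, simplified]])
         (auto intro: always_eventually le)
  qed (rule meas)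
qed

lemma has_Bochner_int_bounded_linear:
  fixes f :: "'s \<Rightarrow> 'a::real_normed_vector" and T :: "'a \<Rightarrow> 'b::real_normed_vector"
  assumes T: "bounded_linear T" and int: "has_Bochner_int M f y"
  shows "has_Bochner_int M (\<lambda>x. T (f x)) (T y)"
proof -
  interpret T: bounded_linear T by (rule T)
  from int obtain s where f: "f \<in> borel_measurable M"
    and s: "\<And>i::nat. Bochner_Integration.simple_bochner_integrable M (s i)"
    and s1: "(\<lambda>i. \<integral>\<^sup>+t. ennreal (norm (f t - s i t)) \<partial>M) \<longlonglongrightarrow> 0"
    and s2: "(\<lambda>i. Bochner_Integration.simple_bochner_integral M (s i)) \<longlonglongrightarrow> y"
    unfolding has_Bochner_int_def by blast
  note [measurable] = measurable_norm_diff_simple[OF f s]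
  obtain K where K: "K > 0" "\<And>x. norm (T x) \<le> norm x * K"
    using T.pos_bounded by blast
  show ?thesis
    unfolding has_Bochner_int_def
  proof (intro conjI exI allI)
    show "(\<lambda>x. T (f x)) \<in> borel_measurable M"
      by (rule measurable_compose[OF f])
         (intro borel_measurable_continuous_onI T.continuous_on continuous_on_id)
    show "Bochner_Integration.simple_bochner_integrable M (\<lambda>x. T (s i x))" for i
      by (rule simple_bochner_integrable_compose2[of "\<lambda>x y. T x", OF _ s s]) (simp add: T.zero)
    show "(\<lambda>i. Bochner_Integration.simple_bochner_integral M (\<lambda>x. T (s i x))) \<longlonglongrightarrow> T y"
      by (simp add: simple_bochner_integral_linear[OF T.linear_axioms s] T.tendsto s2)
    have le: "(\<integral>\<^sup>+t. norm (T (f t) - T (s i t)) \<partial>M) \<le> ennreal K * (\<integral>\<^sup>+t. norm (f t - s i t) \<partial>M)" for i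
    proof -
      have "(\<integral>\<^sup>+t. norm (T (f t) - T (s i t)) \<partial>M) \<le> (\<integral>\<^sup>+t. ennreal K * ennreal (norm (f t - s i t)) \<partial>M)"
        using K by (intro nn_integral_mono)
          (auto simp: T.diff[symmetric] ennreal_mult[symmetric] mult.commute)
      also have "\<dots> = ennreal K * (\<integral>\<^sup>+t. norm (f t - s i t) \<partial>M)"
        by (intro nn_integral_cmult) auto
      finally show ?thesis .
    qed
    have lim: "(\<lambda>i. ennreal K * (\<integral>\<^sup>+t. norm (f t - s i t) \<partial>M)) \<longlonglongrightarrow> 0"
      using ennreal_tendsto_cmult[OF _ s1, of "ennreal K"] by simp
    show "(\<lambda>i. \<integral>\<^sup>+t. norm (T (f t) - T (s i t)) \<partial>M) \<longlonglongrightarrow> 0"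
      by (rule tendsto_sandwich[OF _ _ tendsto_const lim]) (auto intro: always_eventually le)
  qed
qed

lemma has_Bochner_int_diff:
  fixes f g :: "'s \<Rightarrow> 'a::real_normed_vector"
  assumes f: "has_Bochner_int M f y" and g: "has_Bochner_int M g z"
    and meas: "(\<lambda>x. f x - g x) \<in> borel_measurable M"
  shows "has_Bochner_int M (\<lambda>x. f x - g x) (y - z)"
  using has_Bochner_int_add[OF f
      has_Bochner_int_bounded_linear[OF bounded_linear_minus[OF bounded_linear_ident] g]] meas
  by simp

text \<open>Needed for scalar operators, whose integrand is a real function times a fixed
  vector.\<close>

lemma has_Bochner_int_iff_has_bochner_integral:
  fixes f :: "'s \<Rightarrow> 'a::{real_normed_vector, second_countable_topology}"
  shows "has_Bochner_int M f y \<longleftrightarrow> has_bochner_integral M f y"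
  unfolding has_Bochner_int_def has_bochner_integral.simps by blast

text \<open>A continuous integrand which is dominated by a decreasing function is approximated, with the
  same bound, by sampling it at the next larger multiple of \<open>1 / n\<close>.\<close>

lemma ex_has_Bochner_int_continuous:
  fixes f :: "real \<Rightarrow> 'a::banach"
  assumes sets: "sets M = sets (restrict_space borel {0<..})"
    and fin: "(\<integral>\<^sup>+t. ennreal (1 / (1 + t)) \<partial>M) < \<infinity>"
    and cont: "continuous_on {0<..} f"
    and bnd: "\<And>t. t > 0 \<Longrightarrow> norm (f t) \<le> C / (1 + t)"
  shows "\<exists>y. has_Bochner_int M f y"
proof -
  have space: "space M = {0<..}"
    using sets_eq_imp_space_eq[OF sets] by (simp add: space_restrict_space)
  have [measurable_cong]: "sets M = sets (restrict_space borel {0<..})"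
    by (rule sets)
  have f: "f \<in> borel_measurable M"
    using borel_measurable_continuous_on_restrict[OF cont] by (simp cong: measurable_cong_sets add: sets)
  have idm[measurable]: "(\<lambda>t. t) \<in> borel_measurable M"
    by (simp add: measurable_cong_sets[OF sets refl] measurable_restrict_space1)
  have C: "C \<ge> 0"
    using order_trans[OF norm_ge_zero bnd[of 1]] by simp
  \<comment> \<open>\<open>Suc n\<close> is both the inverse mesh and the cutoff, so
    \<open>k n\<close> has finitely many values. Index 0 marks the points beyond the cutoff, where
    \<open>g\<close> gives 0; the ceiling of a positive number is never 0, so the mark is
    unambiguous.\<close>
  define k where "k n t = (if t \<le> real (Suc n) then nat \<lceil>real (Suc n) * t\<rceil> else 0)" for n t
  define g where "g n i = (if i = 0 then 0 else f (real i / real (Suc n)))" for n and i :: nat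
  define s where "s n t = g n (k n t)" for n t
  have k_le: "t \<le> real (k n t) / real (Suc n)" "real (k n t) / real (Suc n) \<le> t + 1 / real (Suc n)"
    "k n t > 0" if "t > 0" "t \<le> real (Suc n)" for n t
  proof -
    define N where "N = real (Suc n)"
    have N: "N > 0" by (simp add: N_def)
    have e: "real (k n t) = of_int \<lceil>N * t\<rceil>"
      using that N unfolding k_def N_def[symmetric]
      by (simp add: less_le_trans[OF _ le_of_int_ceiling])
    have 1: "N * t \<le> real (k n t)" "real (k n t) \<le> N * t + 1"
      unfolding e by linarith+
    show "t \<le> real (k n t) / real (Suc n)"
      using 1 N unfolding N_def[symmetric] by (simp add: field_simps)
    show "real (k n t) / real (Suc n) \<le> t + 1 / real (Suc n)"
      using 1 N unfolding N_def[symmetric] by (simp add: field_simps)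
    have "N * t > 0" using N that by simp
    then show "k n t > 0" using 1 by linarith
  qed
  have k_fin: "simple_function M (k n)" for n
  proof -
    have [measurable]: "k n \<in> measurable M (count_space UNIV)"
      unfolding k_def by measurable
    have "k n ` space M \<subseteq> {..Suc n * Suc n}"
    proof safe
      fix t assume t: "t \<in> space M"
      show "k n t \<le> Suc n * Suc n"
      proof (cases "t \<le> real (Suc n)")
        case True
        then have "real (Suc n) * t \<le> real (Suc n) * real (Suc n)"
          by (intro mult_left_mono) auto
        also have "\<dots> = of_int (int (Suc n * Suc n))"
          by (metis of_int_of_nat_eq of_nat_mult)
        finally have "\<lceil>real (Suc n) * t\<rceil> \<le> int (Suc n * Suc n)"
          by (rule ceiling_le)
        then show ?thesis
          by (simp only: k_def True if_True nat_le_iff)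
      qed (simp add: k_def)
    qed
    then have "finite (k n ` space M)"
      by (rule finite_subset) simp
    then show ?thesis
      by (auto simp: simple_function_def)
  qed
  have s_simple: "simple_function M (s n)" for n
    unfolding s_def using k_fin by (rule simple_function_compose1)
  have s_bnd: "norm (s n t) \<le> C / (1 + t)" if "t > 0" for n t
  proof (cases "t \<le> real (Suc n)")
    case True
    note k = k_le[OF that True]
    have "norm (s n t) = norm (f (real (k n t) / real (Suc n)))"
      using k by (simp add: s_def g_def)
    also have "\<dots> \<le> C / (1 + real (k n t) / real (Suc n))"
      using k that by (intro bnd) linarith
    also have "\<dots> \<le> C / (1 + t)"
      using k that C by (intro divide_left_mono mult_pos_pos) auto
    finally show ?thesis .
  qed (use that C in \<open>simp add: s_def k_def g_def\<close>)
  have bound_fin: "(\<integral>\<^sup>+t. ennreal (D / (1 + t)) \<partial>M) < \<infinity>" if "D \<ge> 0" for D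
  proof -
    have "(\<integral>\<^sup>+t. ennreal (D / (1 + t)) \<partial>M) = (\<integral>\<^sup>+t. ennreal D * ennreal (1 / (1 + t)) \<partial>M)"
      using that by (intro nn_integral_cong) (simp add: space ennreal_mult[symmetric])
    also have "\<dots> = ennreal D * (\<integral>\<^sup>+t. ennreal (1 / (1 + t)) \<partial>M)"
      by (intro nn_integral_cmult) measurable
    also have "\<dots> < \<infinity>"
      using fin by (simp add: ennreal_mult_less_top)
    finally show ?thesis .
  qed
  have s: "Bochner_Integration.simple_bochner_integrable M (s n)" for n
  proof (rule simple_bochner_integrableI_bounded[OF s_simple])
    have "(\<integral>\<^sup>+t. norm (s n t) \<partial>M) \<le> (\<integral>\<^sup>+t. ennreal (C / (1 + t)) \<partial>M)"
      by (intro nn_integral_mono ennreal_leI s_bnd) (simp add: space)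
    then show "(\<integral>\<^sup>+t. norm (s n t) \<partial>M) < \<infinity>"
      using bound_fin[OF C] by (rule le_less_trans)
  qed
  have pointwise: "(\<lambda>n. s n t) \<longlonglongrightarrow> f t" if t: "t > 0" for t
  proof -
    have ev: "\<forall>\<^sub>F n in sequentially. t \<le> real (Suc n)"
      using eventually_ge_at_top[of "nat \<lceil>t\<rceil>"] by eventually_elim linarith
    have a: "(\<lambda>n. real (k n t) / real (Suc n)) \<longlonglongrightarrow> t"
    proof (rule tendsto_sandwich)
      show "\<forall>\<^sub>F n in sequentially. t \<le> real (k n t) / real (Suc n)"
        using ev by eventually_elim (use t k_le in auto)
      show "\<forall>\<^sub>F n in sequentially. real (k n t) / real (Suc n) \<le> t + 1 / real (Suc n)"
        using ev by eventually_elim (use t k_le in auto)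
      show "(\<lambda>n. t + 1 / real (Suc n)) \<longlonglongrightarrow> t"
        using tendsto_add[OF tendsto_const[of t] lim_1_over_n[THEN LIMSEQ_Suc]] by simp
    qed simp
    have "isCont f t"
      using cont t by (simp add: continuous_on_eq_continuous_at)
    then have "(\<lambda>n. f (real (k n t) / real (Suc n))) \<longlonglongrightarrow> f t"
      using a by (rule isCont_tendsto_compose)
    moreover have "\<forall>\<^sub>F n in sequentially. f (real (k n t) / real (Suc n)) = s n t"
      using ev by eventually_elim (simp add: s_def g_def k_le(3)[OF t, THEN gr_implies_not0])
    ultimately show ?thesis
      by (rule Lim_transform_eventually)
  qed
  note [measurable] = measurable_norm_diff_simple[OF f s]
  have conv: "(\<lambda>n. \<integral>\<^sup>+t. norm (f t - s n t) \<partial>M) \<longlonglongrightarrow> (\<integral>\<^sup>+t. 0 \<partial>M)"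
  proof (rule nn_integral_dominated_convergence)
    show "(\<integral>\<^sup>+t. ennreal (2 * C / (1 + t)) \<partial>M) < \<infinity>"
      using C by (intro bound_fin) simp
    show "AE t in M. ennreal (norm (f t - s n t)) \<le> ennreal (2 * C / (1 + t))" for n
    proof (intro AE_I2 ennreal_leI)
      fix t assume "t \<in> space M"
      then have t: "t > 0" by (simp add: space)
      show "norm (f t - s n t) \<le> 2 * C / (1 + t)"
        using norm_triangle_ineq4[of "f t" "s n t"] bnd[OF t] s_bnd[OF t, of n] by simp
    qed
    show "AE t in M. (\<lambda>n. ennreal (norm (f t - s n t))) \<longlonglongrightarrow> 0"
    proof (intro AE_I2)
      fix t assume "t \<in> space M"
      then have t: "t > 0" by (simp add: space)
      have "(\<lambda>n. norm (f t - s n t)) \<longlonglongrightarrow> norm (f t - f t)"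
        by (intro tendsto_intros pointwise t)
      then show "(\<lambda>n. ennreal (norm (f t - s n t))) \<longlonglongrightarrow> 0"
        using tendsto_ennrealI by force
    qed
  qed measurable
  have "Cauchy (\<lambda>n. Bochner_Integration.simple_bochner_integral M (s n))"
  proof (rule metric_CauchyI)
    fix e :: real assume "e > 0"
    then have "\<forall>\<^sub>F n in sequentially. (\<integral>\<^sup>+t. norm (f t - s n t) \<partial>M) < ennreal (e / 2)"
      using conv by (intro order_tendstoD) auto
    then obtain N where N: "\<And>n. n \<ge> N \<Longrightarrow> (\<integral>\<^sup>+t. norm (f t - s n t) \<partial>M) < ennreal (e / 2)"
      by (auto simp: eventually_sequentially)
    have "dist (Bochner_Integration.simple_bochner_integral M (s m)) (Bochner_Integration.simple_bochner_integral M (s n)) < e"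
      if "m \<ge> N" "n \<ge> N" for m n
    proof -
      have "ennreal (dist (Bochner_Integration.simple_bochner_integral M (s m)) (Bochner_Integration.simple_bochner_integral M (s n)))
          \<le> (\<integral>\<^sup>+t. norm (f t - s m t) \<partial>M) + (\<integral>\<^sup>+t. norm (f t - s n t) \<partial>M)"
        by (rule simple_bochner_integral_dist_le[OF f s s])
      also have "\<dots> < ennreal (e / 2) + ennreal (e / 2)"
        using that by (intro add_strict_mono N)
      also have "\<dots> = ennreal e"
        using \<open>e > 0\<close> by (simp flip: ennreal_plus)
      finally show ?thesis
        by (simp add: ennreal_less_iff)
    qed
    then show "\<exists>N. \<forall>m\<ge>N. \<forall>n\<ge>N. dist (Bochner_Integration.simple_bochner_integral M (s m)) (Bochner_Integration.simple_bochner_integral M (s n)) < e"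
      by blast
  qed
  \<comment> \<open>Completeness of the target space enters this lemma only here.\<close>
  then obtain y where "(\<lambda>n. Bochner_Integration.simple_bochner_integral M (s n)) \<longlonglongrightarrow> y"
    by (auto simp: Cauchy_convergent_iff convergent_def)
  with f s conv show ?thesis
    by (auto simp: has_Bochner_int_def)
qed

section \<open>Nonpositive operators\<close>

lemma bounded_linear_scaleC: "bounded_linear (\<lambda>x::'a::complex_normed_vector. c *\<^sub>C x)"
proof (rule bounded_linear_intro[of _ "cmod c"])
  show "c *\<^sub>C (r *\<^sub>R x) = r *\<^sub>R (c *\<^sub>C x)" for r and x :: 'a
    by (simp add: scaleC_of_real[symmetric] scaleC_scaleC mult.commute)
qed (simp_all add: scaleC_add_right norm_scaleC mult.commute)

lemma scaleC_diff_right: "c *\<^sub>C (x - y) = c *\<^sub>C x - c *\<^sub>C y"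
  for x y :: "'a::complex_normed_vector"
  by (intro linear_diff bounded_linear.linear bounded_linear_scaleC)

lemma bounded_clinear_imp_bounded_linear: "bounded_clinear f \<Longrightarrow> bounded_linear f"
  by (simp add: bounded_clinear_def)

text \<open>Continuous maps that agree on a dense set are equal, which settles the
  \<open>THE\<close> in \<open>bounded_ext\<close>. Any bounded complex-linear extension that has
  been found is therefore the one whose norm occurs in the operator Lipschitz condition.\<close>

lemma bounded_ext_eqI:
  assumes dense: "closure D = UNIV" and S: "bounded_clinear S" "\<And>x. x \<in> D \<Longrightarrow> S x = F x"
  shows "bounded_ext D F = S"
  unfolding bounded_ext_def
proof (rule the_equality)
  fix T assume T: "bounded_clinear T \<and> (\<forall>x\<in>D. T x = F x)"
  show "T = S"
  proof
    fix x
    have "x \<in> closure D" using dense by simp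
    then obtain u where u: "\<And>n. u n \<in> D" "u \<longlonglongrightarrow> x"
      by (auto simp: closure_sequential)
    have "(\<lambda>n. S (u n)) \<longlonglongrightarrow> S x" "(\<lambda>n. T (u n)) \<longlonglongrightarrow> T x"
      using bounded_linear.tendsto[OF bounded_clinear_imp_bounded_linear u(2)] S T by blast+
    moreover have "T (u n) = S (u n)" for n
      using S T u by simp
    ultimately show "T x = S x"
      using LIMSEQ_unique by auto
  qed
qed (use S in simp)

text \<open>Linearity and the bound make \<open>F\<close> Lipschitz, hence uniformly continuous on
  \<open>D\<close>, so it extends to the closure by completeness; the algebraic identities and the
  bound pass to limits. The bound with the same \<open>K\<close> is part of the conclusion because
  it later yields the norm estimate for the extension.\<close>

lemma ex_bounded_clinear_extension:
  fixes F :: "'a::complex_normed_vector \<Rightarrow> 'b::complex_banach"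
  assumes dense: "closure D = UNIV"
    and D_add: "\<And>x y. x \<in> D \<Longrightarrow> y \<in> D \<Longrightarrow> x + y \<in> D"
    and D_scale: "\<And>c x. x \<in> D \<Longrightarrow> c *\<^sub>C x \<in> D"
    and F_add: "\<And>x y. x \<in> D \<Longrightarrow> y \<in> D \<Longrightarrow> F (x + y) = F x + F y"
    and F_scale: "\<And>c x. x \<in> D \<Longrightarrow> F (c *\<^sub>C x) = c *\<^sub>C F x"
    and F_le: "\<And>x. x \<in> D \<Longrightarrow> norm (F x) \<le> K * norm x"
  shows "\<exists>S. bounded_clinear S \<and> (\<forall>x\<in>D. S x = F x) \<and> (\<forall>x. norm (S x) \<le> K * norm x)"
proof -
  have minus: "- x = (-1) *\<^sub>C x" for x :: "'c::complex_normed_vector"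
    using scaleC_of_real[of "-1" x] by simp
  have F_diff: "F (x - y) = F x - F y" and D_diff: "x - y \<in> D" if "x \<in> D" "y \<in> D" for x y
    using F_add[OF that(1) D_scale[OF that(2), of "-1"]] F_scale[OF that(2), of "-1"]
      D_add[OF that(1) D_scale[OF that(2), of "-1"]] by (simp_all flip: minus)
  \<comment> \<open>A Lipschitz constant must be nonnegative, whereas \<open>K\<close> is
    arbitrary.\<close>
  have "(max K 0)-lipschitz_on D F"
  proof (rule lipschitz_onI)
    fix x y assume xy: "x \<in> D" "y \<in> D"
    have "dist (F x) (F y) \<le> K * norm (x - y)"
      using F_le[OF D_diff[OF xy]] F_diff[OF xy] by (simp add: dist_norm)
    also have "\<dots> \<le> max K 0 * dist x y"
      by (simp add: dist_norm mult_right_mono)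
    finally show "dist (F x) (F y) \<le> max K 0 * dist x y" .
  qed simp
  then have "uniformly_continuous_on D F"
    by (rule lipschitz_on_uniformly_continuous)
  then obtain S where unif: "uniformly_continuous_on (closure D) S"
    and S: "\<And>x. x \<in> D \<Longrightarrow> F x = S x"
    using uniformly_continuous_on_extension_on_closure by metis
  have "continuous_on UNIV S"
    using uniformly_continuous_imp_continuous[OF unif] dense by simp
  then have lim: "(\<lambda>n. S (u n)) \<longlonglongrightarrow> S x" if "u \<longlonglongrightarrow> x" for u x
    using that by (auto simp: continuous_on_eq_continuous_at intro: isCont_tendsto_compose)
  have approx: "\<exists>u. (\<forall>n. u n \<in> D) \<and> u \<longlonglongrightarrow> x" for x
  proof -
    have "x \<in> closure D" using dense by simp
    then show ?thesis by (simp add: closure_sequential)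
  qed
  have S_add: "S (x + y) = S x + S y" for x y
  proof -
    obtain u where u: "\<And>n. u n \<in> D" "u \<longlonglongrightarrow> x"
      using approx[of x] by auto
    obtain v where v: "\<And>n. v n \<in> D" "v \<longlonglongrightarrow> y"
      using approx[of y] by auto
    have "(\<lambda>n. S (u n + v n)) \<longlonglongrightarrow> S (x + y)"
      by (intro lim tendsto_add u v)
    moreover have "(\<lambda>n. S (u n) + S (v n)) \<longlonglongrightarrow> S x + S y"
      by (intro lim tendsto_add u v)
    moreover have "S (u n + v n) = S (u n) + S (v n)" for n
      using u v D_add F_add by (simp flip: S)
    ultimately show ?thesis
      by (simp add: LIMSEQ_unique)
  qed
  have S_scale: "S (c *\<^sub>C x) = c *\<^sub>C S x" for c x
  proof -
    obtain u where u: "\<And>n. u n \<in> D" "u \<longlonglongrightarrow> x"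
      using approx[of x] by auto
    have "(\<lambda>n. S (c *\<^sub>C u n)) \<longlonglongrightarrow> S (c *\<^sub>C x)"
      by (intro lim bounded_linear.tendsto[OF bounded_linear_scaleC] u)
    moreover have "(\<lambda>n. c *\<^sub>C S (u n)) \<longlonglongrightarrow> c *\<^sub>C S x"
      by (intro lim bounded_linear.tendsto[OF bounded_linear_scaleC] u)
    moreover have "S (c *\<^sub>C u n) = c *\<^sub>C S (u n)" for n
      using u D_scale F_scale by (simp flip: S)
    ultimately show ?thesis
      by (simp add: LIMSEQ_unique)
  qed
  have S_le: "norm (S x) \<le> K * norm x" for x
  proof -
    obtain u where u: "\<And>n. u n \<in> D" "u \<longlonglongrightarrow> x"
      using approx[of x] by auto
    have "(\<lambda>n. norm (S (u n))) \<longlonglongrightarrow> norm (S x)" "(\<lambda>n. K * norm (u n)) \<longlonglongrightarrow> K * norm x"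
      by (intro tendsto_intros lim u)+
    moreover have "norm (S (u n)) \<le> K * norm (u n)" for n
      using u F_le by (simp flip: S)
    ultimately show ?thesis
      by (auto intro: LIMSEQ_le)
  qed
  have "bounded_linear S"
  proof (rule bounded_linear_intro[of _ K])
    show "S (r *\<^sub>R x) = r *\<^sub>R S x" for r x
      by (simp add: S_scale flip: scaleC_of_real)
  qed (simp_all add: S_add S_le mult.commute)
  then have "bounded_clinear S"
    by (simp add: bounded_clinear_def S_scale)
  then show ?thesis
    using S S_le by (intro exI[of _ S]) simp
qed

section \<open>Resolvents of a single nonpositive operator\<close>

locale nonpositive_operator =
  fixes A :: "'a::complex_banach rel" and c :: real
  assumes NP_le: "A \<in> NP_le c"
begin

abbreviation R :: "real \<Rightarrow> 'a \<Rightarrow> 'a" where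
  "R t \<equiv> resolvent (complex_of_real t) A"

lemma linear_operator: "linear_operator A"
  and dense: "closure (Domain A) = UNIV"
  and resolvent_set: "t > 0 \<Longrightarrow> complex_of_real t \<in> resolvent_set A"
  and nonpos_const_le: "nonpos_const A \<le> ereal c"
  using NP_le by (auto simp: NP_le_def NP_def)

lemma op_apply_eqI: "(x, y) \<in> A \<Longrightarrow> op_apply A x = y"
  using linear_operator by (auto simp: op_apply_def linear_operator_def single_valued_def)

lemma op_apply_in: "x \<in> Domain A \<Longrightarrow> (x, op_apply A x) \<in> A"
  using op_apply_eqI by blast

lemma
  assumes x: "x \<in> Domain A" and y: "y \<in> Domain A"
  shows add_in_Domain: "x + y \<in> Domain A"
    and op_apply_add: "op_apply A (x + y) = op_apply A x + op_apply A y"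
proof -
  have "(x + y, op_apply A x + op_apply A y) \<in> A"
    using linear_operator op_apply_in[OF x] op_apply_in[OF y] by (simp add: linear_operator_def)
  then show "x + y \<in> Domain A" "op_apply A (x + y) = op_apply A x + op_apply A y"
    by (auto intro: op_apply_eqI)
qed

lemma
  assumes x: "x \<in> Domain A"
  shows scaleC_in_Domain: "a *\<^sub>C x \<in> Domain A"
    and op_apply_scaleC: "op_apply A (a *\<^sub>C x) = a *\<^sub>C op_apply A x"
proof -
  have "(a *\<^sub>C x, a *\<^sub>C op_apply A x) \<in> A"
    using linear_operator op_apply_in[OF x] by (simp add: linear_operator_def)
  then show "a *\<^sub>C x \<in> Domain A" "op_apply A (a *\<^sub>C x) = a *\<^sub>C op_apply A x"
    by (auto intro: op_apply_eqI)
qed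

lemma op_apply_zero: "op_apply A 0 = 0"
  using linear_operator by (intro op_apply_eqI) (simp add: linear_operator_def)

lemma bij_betw_resolvent:
  assumes "t > 0"
  shows "bij_betw (\<lambda>x. t *\<^sub>R x - op_apply A x) (Domain A) UNIV"
  using resolvent_set[OF assms] by (simp add: resolvent_set_def scaleC_of_real)

lemma resolvent_eq: "R t = inv_into (Domain A) (\<lambda>x. t *\<^sub>R x - op_apply A x)"
  by (simp add: resolvent_def scaleC_of_real)

lemma resolvent_in_Domain: "t > 0 \<Longrightarrow> R t x \<in> Domain A"
  using bij_betw_resolvent[of t] unfolding resolvent_eq
  by (intro inv_into_into) (auto simp: bij_betw_def)

lemma op_apply_resolvent: "t > 0 \<Longrightarrow> op_apply A (R t x) = t *\<^sub>R R t x - x"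
  using bij_betw_inv_into_right[OF bij_betw_resolvent[of t], of x] unfolding resolvent_eq
  by (simp add: algebra_simps)

lemma resolvent_left: "t > 0 \<Longrightarrow> x \<in> Domain A \<Longrightarrow> R t (t *\<^sub>R x - op_apply A x) = x"
  using bij_betw_inv_into_left[OF bij_betw_resolvent[of t], of x] unfolding resolvent_eq
  by simp

lemma bounded_clinear_resolvent: "t > 0 \<Longrightarrow> bounded_clinear (R t)"
  using resolvent_set[of t] by (simp add: resolvent_set_def)

lemmas bounded_linear_resolvent = bounded_clinear_resolvent[THEN bounded_clinear_imp_bounded_linear]

lemma resolvent_diff_right: "t > 0 \<Longrightarrow> R t (x - y) = R t x - R t y"
  and resolvent_scaleR: "t > 0 \<Longrightarrow> R t (r *\<^sub>R x) = r *\<^sub>R R t x"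
  using bounded_linear_resolvent[of t]
  by (auto intro: linear_diff linear_scale bounded_linear.linear)

lemma onorm_resolvent_le:
  assumes t: "t > 0"
  shows "onorm (\<lambda>x. t *\<^sub>R R t x) \<le> c"
proof -
  have "ereal (onorm (\<lambda>x. t *\<^sub>R R t x)) \<le> nonpos_const A"
    unfolding nonpos_const_def using t by (intro SUP_upper) simp
  then show ?thesis
    using nonpos_const_le by (meson ereal_less_eq(3) order_trans)
qed

lemma const_nonneg: "c \<ge> 0"
  using onorm_resolvent_le[of 1] onorm_pos_le[OF bounded_linear_resolvent[of 1]] by simp

lemma mult_norm_resolvent_le:
  assumes t: "t > 0"
  shows "t * norm (R t x) \<le> c * norm x"
proof -
  have "norm (t *\<^sub>R R t x) \<le> onorm (\<lambda>x. t *\<^sub>R R t x) * norm x"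
    by (intro onorm bounded_linear_compose[OF bounded_linear_scaleR_right bounded_linear_resolvent] t)
  also have "\<dots> \<le> c * norm x"
    by (intro mult_right_mono onorm_resolvent_le t) simp
  finally show ?thesis
    using t by simp
qed

lemma norm_resolvent_le: "t > 0 \<Longrightarrow> norm (R t x) \<le> c / t * norm x"
  using mult_norm_resolvent_le[of t x] by (simp add: pos_le_divide_eq mult.commute)

lemma op_apply_resolvent_commute:
  assumes "t > 0" "x \<in> Domain A"
  shows "op_apply A (R t x) = R t (op_apply A x)"
  using resolvent_left[OF assms]
  by (simp add: op_apply_resolvent resolvent_diff_right resolvent_scaleR assms algebra_simps)

lemma resolvent_identity:
  assumes "s > 0" "t > 0"
  shows "R s x - R t x = (t - s) *\<^sub>R R s (R t x)"
proof -
  have "R s x - R t x = R s x - R s (s *\<^sub>R R t x - op_apply A (R t x))"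
    using assms by (simp add: resolvent_left resolvent_in_Domain)
  also have "\<dots> = (t - s) *\<^sub>R R s (R t x)"
    using assms by (simp add: op_apply_resolvent algebra_simps flip: resolvent_diff_right resolvent_scaleR)
  finally show ?thesis .
qed

lemma resolvent_commute:
  assumes "s > 0" "t > 0"
  shows "R s (R t x) = R t (R s x)"
proof (cases "s = t")
  case False
  have "(t - s) *\<^sub>R R s (R t x) = (t - s) *\<^sub>R R t (R s x)"
    using resolvent_identity[OF assms, of x] resolvent_identity[OF assms(2,1), of x]
    by (metis minus_diff_eq scaleR_minus_left)
  then show ?thesis using False by simp
qed simp

text \<open>By the resolvent identity R(s,A) x - R(t,A) x = (t - s) R(s,A) R(t,A) x, and the norm of
  R(s,A) is at most c/s, which stays bounded as s tends to t. This is the source of measurability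
  for the operator-theoretic integrands.\<close>

lemma continuous_on_resolvent: "continuous_on {0<..} (\<lambda>t. R t x)"
proof -
  have "((\<lambda>s. R s x) \<longlongrightarrow> R t x) (at t)" if t: "t > 0" for t
  proof (rule LIM_zero_cancel, rule Lim_null_comparison)
    show "\<forall>\<^sub>F s in at t. norm (R s x - R t x) \<le> \<bar>t - s\<bar> * (c / s * norm (R t x))"
    proof -
      have "\<forall>\<^sub>F s in at t. s > 0"
        using order_tendstoD(1)[OF tendsto_ident_at t] .
      then show ?thesis
      proof eventually_elim
        case (elim s)
        have "\<bar>t - s\<bar> * norm (R s (R t x)) \<le> \<bar>t - s\<bar> * (c / s * norm (R t x))"
          by (intro mult_left_mono norm_resolvent_le elim) simp
        then show ?case
          by (simp add: resolvent_identity elim t)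
      qed
    qed
    show "((\<lambda>s. \<bar>t - s\<bar> * (c / s * norm (R t x))) \<longlongrightarrow> 0) (at t)"
      using t by (auto intro!: tendsto_eq_intros)
  qed
  then show ?thesis
    by (simp add: continuous_on_eq_continuous_at isCont_def)
qed

lemma continuous_on_op_apply_resolvent: "continuous_on {0<..} (\<lambda>t. op_apply A (R t x))"
proof -
  have "continuous_on {0<..} (\<lambda>t. t *\<^sub>R R t x - x)"
    by (intro continuous_intros continuous_on_resolvent)
  also have "?this \<longleftrightarrow> ?thesis"
    by (intro continuous_on_cong) (simp_all add: op_apply_resolvent)
  finally show ?thesis .
qed

text \<open>Two estimates are added. A R(t,A) = t R(t,A) - I is bounded uniformly in t, which serves
  small t; on D(A) also A R(t,A) x = R(t,A) A x, which decays like 1/t. Together they give the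
  weight 1/(1 + t) that the representing measure integrates.\<close>

lemma norm_op_apply_resolvent_le:
  assumes t: "t > 0" and x: "x \<in> Domain A"
  shows "norm (op_apply A (R t x)) \<le> ((c + 1) * norm x + c * norm (op_apply A x)) / (1 + t)"
proof -
  have "norm (op_apply A (R t x)) \<le> t * norm (R t x) + norm x"
    using norm_triangle_ineq4[of "t *\<^sub>R R t x" x] t by (simp add: op_apply_resolvent)
  also have "\<dots> \<le> (c + 1) * norm x"
    using mult_norm_resolvent_le[OF t, of x] by (simp add: distrib_right)
  finally have 1: "norm (op_apply A (R t x)) \<le> (c + 1) * norm x" .
  have 2: "t * norm (op_apply A (R t x)) \<le> c * norm (op_apply A x)"
    using mult_norm_resolvent_le[OF t, of "op_apply A x"]
    by (simp add: op_apply_resolvent_commute x t)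
  have "norm (op_apply A (R t x)) * (1 + t) \<le> (c + 1) * norm x + c * norm (op_apply A x)"
    using add_mono[OF 1 2] by (simp add: algebra_simps)
  then show ?thesis
    using t by (simp add: pos_le_divide_eq)
qed

end

section \<open>Representing measures and the operator \<phi>(A) on D(A)\<close>

locale Stieltjes_measure =
  fixes \<mu> :: "real measure"
  assumes sets_eq[measurable_cong]: "sets \<mu> = sets (restrict_space borel {0<..})"
    and finite_integral: "(\<integral>\<^sup>+t. ennreal (1 / (1 + t)) \<partial>\<mu>) < \<infinity>"
begin

lemma space_eq: "space \<mu> = {0<..}"
  using sets_eq_imp_space_eq[OF sets_eq] by (simp add: space_restrict_space)

lemma measurable_ident[measurable]: "(\<lambda>t. t) \<in> borel_measurable \<mu>"
  by (simp add: measurable_cong_sets[OF sets_eq refl] measurable_restrict_space1)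

lemma measurable_continuous: "continuous_on {0<..} f \<Longrightarrow> f \<in> borel_measurable \<mu>"
  for f :: "real \<Rightarrow> 'b::topological_space"
  using borel_measurable_continuous_on_restrict by (simp cong: measurable_cong_sets add: sets_eq)

lemma nn_integral_bound:
  assumes "D \<ge> 0"
  shows "(\<integral>\<^sup>+t. ennreal (D / (1 + t)) \<partial>\<mu>) = ennreal D * (\<integral>\<^sup>+t. ennreal (1 / (1 + t)) \<partial>\<mu>)"
  using assms by (subst nn_integral_cmult[symmetric])
    (auto intro!: nn_integral_cong simp: space_eq ennreal_mult[symmetric])

end

locale operator_calculus = nonpositive_operator A c + Stieltjes_measure \<mu>
  for A :: "'a::complex_banach rel" and c :: real and \<mu> :: "real measure"
begin

lemma ex_integral:
  assumes "x \<in> Domain A"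
  shows "\<exists>y. has_Bochner_int \<mu> (\<lambda>t. op_apply A (R t x)) y"
  by (rule ex_has_Bochner_int_continuous[OF sets_eq finite_integral continuous_on_op_apply_resolvent
        norm_op_apply_resolvent_le[OF _ assms]])

text \<open>Closability: \<open>R 1\<close> is injective, commutes with the integral, and maps into the domain,
  where the integral is controlled by the norm of the argument.\<close>

lemma op_apply_op_calc:
  assumes x: "x \<in> Domain A" and y: "has_Bochner_int \<mu> (\<lambda>t. op_apply A (R t x)) y"
  shows "op_apply (op_calc \<mu> A) x = y"
proof -
  \<comment> \<open>\<open>R 1\<close> abbreviates a resolvent at \<open>complex_of_real 1\<close>;
    simplifying this argument to 1 would keep the lemmas about \<open>R t\<close> from
    matching.\<close>
  note of_real_1[simp del]
  define G where "G = {(x, y). x \<in> Domain A \<and> has_Bochner_int \<mu> (\<lambda>t. op_apply A (R t x)) y}"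
  define I where "I = enn2real (\<integral>\<^sup>+t. ennreal (1 / (1 + t)) \<partial>\<mu>)"
  have I: "(\<integral>\<^sup>+t. ennreal (1 / (1 + t)) \<partial>\<mu>) = ennreal I" "I \<ge> 0"
    using finite_integral by (simp_all add: I_def)
  have bound: "norm (R 1 (y' - y)) \<le> 2 * c * (c + 1) * I * norm (x' - x)" if "(x', y') \<in> G" for x' y'
  proof -
    define u where "u = x' - x"
    have y': "has_Bochner_int \<mu> (\<lambda>t. op_apply A (R t x')) y'"
      using that by (simp add: G_def)
    have eq: "op_apply A (R t (R 1 u)) = R 1 (op_apply A (R t x')) - R 1 (op_apply A (R t x))"
      if "t > 0" for t
    proof -
      have "op_apply A (R t x') - op_apply A (R t x) = t *\<^sub>R R t u - u"
        by (simp add: op_apply_resolvent that u_def resolvent_diff_right algebra_simps)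
      then have "R 1 (op_apply A (R t x')) - R 1 (op_apply A (R t x)) = R 1 (t *\<^sub>R R t u - u)"
        by (simp flip: resolvent_diff_right)
      also have "\<dots> = t *\<^sub>R R t (R 1 u) - R 1 u"
        by (simp add: resolvent_diff_right resolvent_scaleR resolvent_commute[of 1 t] that)
      finally show ?thesis
        by (simp add: op_apply_resolvent that)
    qed
    have R1: "norm (R 1 u) \<le> c * norm u"
      using norm_resolvent_le[of 1 u] by simp
    \<comment> \<open>\<open>R 1 u\<close> lies in D(A), with norm at most c times that of
      \<open>u\<close>, and A maps it to a vector of norm at most (c + 1) times that of
      \<open>u\<close>. Inserted in the decay estimate these give (c + 1) c + c (c + 1), the origin
      of the factor 2 c (c + 1).\<close>
    have le: "norm (op_apply A (R t (R 1 u))) \<le> 2 * c * (c + 1) * norm u / (1 + t)" if t: "t > 0" for t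
    proof -
      have "norm (op_apply A (R 1 u)) \<le> (c + 1) * norm u"
        using norm_triangle_ineq4[of "R 1 u" u] R1 by (simp add: op_apply_resolvent algebra_simps)
      then have "(c + 1) * norm (R 1 u) + c * norm (op_apply A (R 1 u))
          \<le> (c + 1) * (c * norm u) + c * ((c + 1) * norm u)"
        using const_nonneg R1 by (intro add_mono mult_left_mono) auto
      also have "\<dots> = 2 * c * (c + 1) * norm u"
        by (simp add: algebra_simps)
      finally show ?thesis
        using t by (intro order_trans[OF norm_op_apply_resolvent_le[OF t resolvent_in_Domain]]
            divide_right_mono) auto
    qed
    have "has_Bochner_int \<mu> (\<lambda>t. R 1 (op_apply A (R t x')) - R 1 (op_apply A (R t x))) (R 1 y' - R 1 y)"
    proof (rule has_Bochner_int_diff[OF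
          has_Bochner_int_bounded_linear[OF bounded_linear_resolvent y']
          has_Bochner_int_bounded_linear[OF bounded_linear_resolvent y]])
      have "(\<lambda>t. op_apply A (R t (R 1 u))) \<in> borel_measurable \<mu>"
        by (intro measurable_continuous continuous_on_op_apply_resolvent)
      also have "?this \<longleftrightarrow> (\<lambda>t. R 1 (op_apply A (R t x')) - R 1 (op_apply A (R t x))) \<in> borel_measurable \<mu>"
        by (intro measurable_cong) (simp add: eq space_eq)
      finally show "(\<lambda>t. R 1 (op_apply A (R t x')) - R 1 (op_apply A (R t x))) \<in> borel_measurable \<mu>" .
    qed auto
    also have "?this \<longleftrightarrow> has_Bochner_int \<mu> (\<lambda>t. op_apply A (R t (R 1 u))) (R 1 y' - R 1 y)"
      by (intro has_Bochner_int_cong) (simp add: eq space_eq)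
    also have "R 1 y' - R 1 y = R 1 (y' - y)"
      by (simp add: resolvent_diff_right)
    finally have "ennreal (norm (R 1 (y' - y))) \<le> (\<integral>\<^sup>+t. norm (op_apply A (R t (R 1 u))) \<partial>\<mu>)"
      by (rule has_Bochner_int_norm_le)
    also have "\<dots> \<le> (\<integral>\<^sup>+t. ennreal (2 * c * (c + 1) * norm u / (1 + t)) \<partial>\<mu>)"
      by (intro nn_integral_mono ennreal_leI le) (simp add: space_eq)
    also have "\<dots> = ennreal (2 * c * (c + 1) * norm u * I)"
      using const_nonneg by (subst nn_integral_bound) (auto simp: I simp flip: ennreal_mult)
    finally show ?thesis
      using const_nonneg I by (simp add: u_def mult_ac)
  qed
  have "y' = y" if closure: "(x, y') \<in> closure G" for y'
  proof -
    obtain z where z: "\<And>n. z n \<in> G" "z \<longlonglongrightarrow> (x, y')"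
      using closure by (auto simp: closure_sequential)
    have "(\<lambda>n. norm (R 1 (snd (z n) - y))) \<longlonglongrightarrow> norm (R 1 (y' - y))"
      using tendsto_snd[OF z(2)]
      by (intro tendsto_norm bounded_linear.tendsto[OF bounded_linear_resolvent] tendsto_intros) auto
    moreover have "(\<lambda>n. 2 * c * (c + 1) * I * norm (fst (z n) - x)) \<longlonglongrightarrow> 2 * c * (c + 1) * I * norm (x - x)"
      using tendsto_fst[OF z(2)] by (intro tendsto_intros) auto
    ultimately have "norm (R 1 (y' - y)) \<le> 2 * c * (c + 1) * I * norm (x - x)"
      by (rule LIMSEQ_le) (use bound z(1) in auto)
    then have "R 1 (y' - y) = 0" by simp
    \<comment> \<open>Injectivity of \<open>R 1\<close>: if it maps w to 0, then A R(1,A) w = R(1,A)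
      w - w reads 0 = -w.\<close>
    then show "y' = y"
      using op_apply_resolvent[of 1 "y' - y"] by (simp add: op_apply_zero)
  qed
  moreover have "(x, y) \<in> closure G"
    using x y subsetD[OF closure_subset, of "(x, y)" G] by (simp add: G_def)
  ultimately have "(THE y'. (x, y') \<in> closure G) = y"
    by (intro the_equality)
  moreover have "op_calc \<mu> A = closure G"
    by (simp add: op_calc_def G_def)
  ultimately show ?thesis
    by (simp add: op_apply_def)
qed

lemma has_Bochner_int_op_calc:
  assumes "x \<in> Domain A"
  shows "has_Bochner_int \<mu> (\<lambda>t. op_apply A (R t x)) (op_apply (op_calc \<mu> A) x)"
  using ex_integral[OF assms] op_apply_op_calc[OF assms] by auto

lemma op_calc_add:
  assumes x: "x \<in> Domain A" and y: "y \<in> Domain A"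
  shows "op_apply (op_calc \<mu> A) (x + y) = op_apply (op_calc \<mu> A) x + op_apply (op_calc \<mu> A) y"
proof (rule op_apply_op_calc)
  have eq: "op_apply A (R t (x + y)) = op_apply A (R t x) + op_apply A (R t y)" if "t > 0" for t
    using that bounded_linear_resolvent[OF that]
    by (simp add: linear_add bounded_linear.linear op_apply_add resolvent_in_Domain)
  have "has_Bochner_int \<mu> (\<lambda>t. op_apply A (R t x) + op_apply A (R t y))
      (op_apply (op_calc \<mu> A) x + op_apply (op_calc \<mu> A) y)"
    by (intro has_Bochner_int_add has_Bochner_int_op_calc x y measurable_continuous continuous_intros
        continuous_on_op_apply_resolvent)
  then show "has_Bochner_int \<mu> (\<lambda>t. op_apply A (R t (x + y)))
      (op_apply (op_calc \<mu> A) x + op_apply (op_calc \<mu> A) y)"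
    by (subst has_Bochner_int_cong[OF eq]) (auto simp: space_eq)
qed (intro add_in_Domain x y)

lemma op_calc_scaleC:
  assumes x: "x \<in> Domain A"
  shows "op_apply (op_calc \<mu> A) (a *\<^sub>C x) = a *\<^sub>C op_apply (op_calc \<mu> A) x"
proof (rule op_apply_op_calc)
  have eq: "op_apply A (R t (a *\<^sub>C x)) = a *\<^sub>C op_apply A (R t x)" if "t > 0" for t
    using bounded_clinear_resolvent[OF that]
    by (simp add: bounded_clinear_def op_apply_scaleC resolvent_in_Domain that)
  have "has_Bochner_int \<mu> (\<lambda>t. a *\<^sub>C op_apply A (R t x)) (a *\<^sub>C op_apply (op_calc \<mu> A) x)"
    by (intro has_Bochner_int_bounded_linear[OF bounded_linear_scaleC] has_Bochner_int_op_calc x)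
  then show "has_Bochner_int \<mu> (\<lambda>t. op_apply A (R t (a *\<^sub>C x))) (a *\<^sub>C op_apply (op_calc \<mu> A) x)"
    by (subst has_Bochner_int_cong[OF eq]) (auto simp: space_eq)
qed (intro scaleC_in_Domain x)

end

section \<open>The operator Lipschitz estimate\<close>

lemma (in Stieltjes_measure) op_Lipschitz_NP_if_finite:
  assumes fin: "(\<integral>\<^sup>+t. ennreal (1 / t) \<partial>\<mu>) < \<infinity>"
  shows "op_Lipschitz_NP \<mu> TYPE('a::complex_banach)"
  unfolding op_Lipschitz_NP_def
proof (intro allI exI ballI impI, elim conjE)
  define J where "J = enn2real (\<integral>\<^sup>+t. ennreal (1 / t) \<partial>\<mu>)"
  fix c and A B :: "'a rel"
  assume AB: "A \<in> NP_le c" "B \<in> NP_le c" and dom: "Domain A \<subseteq> Domain B"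
    and bdd: "bounded_op_on (Domain A) (op_diff A B)"
  interpret A: operator_calculus A c \<mu> by unfold_locales (rule AB)
  interpret B: operator_calculus B c \<mu> by unfold_locales (rule AB)
  let ?F = "op_diff (op_calc \<mu> A) (op_calc \<mu> B)" and ?T = "bounded_ext (Domain A) (op_diff A B)"
  have J: "(\<integral>\<^sup>+t. ennreal (1 / t) \<partial>\<mu>) = ennreal J" "J \<ge> 0"
    using fin by (simp_all add: J_def)
  from bdd obtain K where K: "\<And>x. x \<in> Domain A \<Longrightarrow> norm (op_diff A B x) \<le> K * norm x"
    by (auto simp: bounded_op_on_def)
  have diff_add: "op_diff A B (x + y) = op_diff A B x + op_diff A B y"
    if "x \<in> Domain A" "y \<in> Domain A" for x y
    using that dom by (simp add: op_diff_def A.op_apply_add B.op_apply_add subset_iff)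
  have diff_scaleC: "op_diff A B (a *\<^sub>C x) = a *\<^sub>C op_diff A B x" if "x \<in> Domain A" for a x
    using that dom by (simp add: scaleC_diff_right op_diff_def A.op_apply_scaleC B.op_apply_scaleC subset_iff)
  obtain T where T: "bounded_clinear T" "\<And>x. x \<in> Domain A \<Longrightarrow> T x = op_diff A B x"
    using ex_bounded_clinear_extension[OF A.dense A.add_in_Domain A.scaleC_in_Domain diff_add diff_scaleC K]
    by blast
  have T_eq: "?T = T"
    by (rule bounded_ext_eqI[OF A.dense T])
  have blT: "bounded_linear T"
    by (rule bounded_clinear_imp_bounded_linear[OF T(1)])
  \<comment> \<open>R(t,A) x lies in D(A), hence in D(B), so it is recovered by R(t,B) from (t - B)
    R(t,A) x, which equals x + T R(t,A) x because T = A - B on D(A). This is where the inclusion of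
    the domains is essential.\<close>
  have resolvent_diff: "A.R t x - B.R t x = B.R t (T (A.R t x))" if t: "t > 0" for t x
  proof -
    have "B.R t (t *\<^sub>R A.R t x - op_apply B (A.R t x)) = A.R t x"
      using dom A.resolvent_in_Domain[OF t] by (intro B.resolvent_left t) auto
    moreover have "t *\<^sub>R A.R t x - op_apply B (A.R t x) = x + T (A.R t x)"
      by (simp add: T(2) A.resolvent_in_Domain op_diff_def A.op_apply_resolvent t)
    moreover have "B.R t (x + T (A.R t x)) = B.R t x + B.R t (T (A.R t x))"
      by (intro linear_add bounded_linear.linear B.bounded_linear_resolvent t)
    ultimately show ?thesis
      by (metis add_diff_cancel_left')
  qed
  have F_le: "norm (?F x) \<le> c\<^sup>2 * J * onorm T * norm x" if x: "x \<in> Domain A" for x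
  proof -
    have "has_Bochner_int \<mu> (\<lambda>t. op_apply A (A.R t x) - op_apply B (B.R t x)) (?F x)"
      unfolding op_diff_def using x dom
      by (intro has_Bochner_int_diff A.has_Bochner_int_op_calc B.has_Bochner_int_op_calc
          measurable_continuous continuous_intros A.continuous_on_op_apply_resolvent
          B.continuous_on_op_apply_resolvent) auto
    then have "ennreal (norm (?F x)) \<le> (\<integral>\<^sup>+t. norm (op_apply A (A.R t x) - op_apply B (B.R t x)) \<partial>\<mu>)"
      by (rule has_Bochner_int_norm_le)
    also have "\<dots> \<le> (\<integral>\<^sup>+t. ennreal (c\<^sup>2 * onorm T * norm x) * ennreal (1 / t) \<partial>\<mu>)"
    proof (intro nn_integral_mono)
      fix t assume "t \<in> space \<mu>"
      then have t: "t > 0" by (simp add: space_eq)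
      \<comment> \<open>Writing A R(t,A) = t R(t,A) - I, and likewise for B, cancels x and leaves t
        times the difference of the resolvents.\<close>
      have "norm (op_apply A (A.R t x) - op_apply B (B.R t x)) = t * norm (B.R t (T (A.R t x)))"
        using t by (simp add: A.op_apply_resolvent B.op_apply_resolvent flip: resolvent_diff)
          (simp flip: scaleR_diff_right)
      also have "\<dots> \<le> t * (c / t * (onorm T * (c / t * norm x)))"
      proof -
        have "norm (T (A.R t x)) \<le> onorm T * (c / t * norm x)"
          by (intro order_trans[OF onorm[OF blT]] mult_left_mono A.norm_resolvent_le t onorm_pos_le blT)
        then have "norm (B.R t (T (A.R t x))) \<le> c / t * (onorm T * (c / t * norm x))"
          using t A.const_nonneg
          by (intro order_trans[OF B.norm_resolvent_le[OF t]] mult_left_mono) auto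
        then show ?thesis using t by (intro mult_left_mono) auto
      qed
      also have "\<dots> = c\<^sup>2 * onorm T * norm x * (1 / t)"
        using t by (simp add: power2_eq_square)
      finally show "ennreal (norm (op_apply A (A.R t x) - op_apply B (B.R t x)))
          \<le> ennreal (c\<^sup>2 * onorm T * norm x) * ennreal (1 / t)"
        using t onorm_pos_le[OF blT] by (simp add: ennreal_leI flip: ennreal_mult)
    qed
    also have "\<dots> = ennreal (c\<^sup>2 * onorm T * norm x) * ennreal J"
      by (subst nn_integral_cmult) (auto simp: J)
    also have "\<dots> = ennreal (c\<^sup>2 * J * onorm T * norm x)"
      using J onorm_pos_le[OF blT] by (simp add: mult_ac flip: ennreal_mult)
    finally show ?thesis
      using J onorm_pos_le[OF blT] by simp
  qed
  have F_add: "?F (x + y) = ?F x + ?F y" if "x \<in> Domain A" "y \<in> Domain A" for x y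
    using that dom by (simp add: op_diff_def A.op_calc_add B.op_calc_add subset_iff)
  have F_scaleC: "?F (a *\<^sub>C x) = a *\<^sub>C ?F x" if "x \<in> Domain A" for a x
    using that dom by (simp add: scaleC_diff_right op_diff_def A.op_calc_scaleC B.op_calc_scaleC subset_iff)
  obtain S where S: "bounded_clinear S" "\<And>x. x \<in> Domain A \<Longrightarrow> S x = ?F x"
    and S_le: "\<And>x. norm (S x) \<le> c\<^sup>2 * J * onorm T * norm x"
    using ex_bounded_clinear_extension[OF A.dense A.add_in_Domain A.scaleC_in_Domain F_add F_scaleC F_le]
    by blast
  have "onorm S \<le> c\<^sup>2 * J * onorm T"
    using S_le J onorm_pos_le[OF blT] by (intro onorm_bound) auto
  moreover have "bounded_ext (Domain A) ?F = S"
    by (rule bounded_ext_eqI[OF A.dense S])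
  moreover have "bounded_op_on (Domain A) ?F"
    unfolding bounded_op_on_def using F_le by (intro exI ballI)
  ultimately show "bounded_op_on (Domain A) ?F \<and>
      onorm (bounded_ext (Domain A) ?F) \<le>
        c\<^sup>2 * enn2real (\<integral>\<^sup>+t. ennreal (1 / t) \<partial>\<mu>) * onorm ?T"
    by (simp add: T_eq J_def)
qed

section \<open>Scalar functions and scalar operators\<close>

context Stieltjes_measure
begin

lemma integrable_shift:
  assumes r: "r > 0"
  shows "integrable \<mu> (\<lambda>t. B / (t + r))"
proof -
  have "integrable \<mu> (\<lambda>t. 1 / (1 + t))"
    using finite_integral by (intro integrableI_nonneg AE_I2) (auto simp: space_eq)
  \<comment> \<open>The factor is chosen so that (1 + 1/r) (t + r) = 1 + t + r + t/r, which is at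
    least 1 + t.\<close>
  then have "integrable \<mu> (\<lambda>t. (1 + 1 / r) * (1 / (1 + t)))"
    by (rule integrable_mult_right)
  then have "integrable \<mu> (\<lambda>t. 1 / (t + r))"
  proof (rule Bochner_Integration.integrable_bound)
    show "AE t in \<mu>. norm (1 / (t + r)) \<le> norm ((1 + 1 / r) * (1 / (1 + t)))"
    proof (intro AE_I2)
      fix t assume "t \<in> space \<mu>"
      then have t: "t > 0" by (simp add: space_eq)
      have "1 + t \<le> (1 + 1 / r) * (t + r)"
        using r t by (simp add: distrib_left distrib_right)
      then have "1 / (t + r) \<le> (1 + 1 / r) / (1 + t)"
        using r t by (simp add: divide_le_eq pos_le_divide_eq)
      then show "norm (1 / (t + r)) \<le> norm ((1 + 1 / r) * (1 / (1 + t)))"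
        using r t by (simp add: abs_of_pos)
    qed
  qed measurable
  then have "integrable \<mu> (\<lambda>t. B * (1 / (t + r)))"
    by (rule integrable_mult_right)
  then show ?thesis by simp
qed

lemma integrable_dominated:
  fixes f :: "real \<Rightarrow> 'b::{banach, second_countable_topology}"
  assumes r: "r > 0" and f: "f \<in> borel_measurable \<mu>"
    and le: "\<And>t. t > 0 \<Longrightarrow> norm (f t) \<le> B / (t + r)"
  shows "integrable \<mu> f"
proof (rule Bochner_Integration.integrable_bound[OF integrable_shift[OF r, of B] f], intro AE_I2)
  fix t assume "t \<in> space \<mu>"
  then show "norm (f t) \<le> norm (B / (t + r))"
    using order_trans[OF le abs_ge_self, of t] by (simp add: space_eq)
qed

text \<open>For fixed t > 0 the kernel increases with \<open>s n\<close> towards 1/t, so monotone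
  convergence applies whether or not the limit is finite. The same kernel serves for the derivative
  at -0 and for the linear bound.\<close>

lemma nn_integral_reciprocal_LIMSEQ:
  assumes inc: "incseq s" and neg: "\<And>n::nat. s n < 0" and lim: "s \<longlonglongrightarrow> (0::real)"
  shows "(\<lambda>n. \<integral>\<^sup>+t. ennreal (t / (t - s n)\<^sup>2) \<partial>\<mu>) \<longlonglongrightarrow> (\<integral>\<^sup>+t. ennreal (1 / t) \<partial>\<mu>)"
proof -
  \<comment> \<open>Monotonicity and convergence will be required at every real t and not only on
    \<open>space \<mu>\<close>; the indicator makes both trivial for t \<le> 0.\<close>
  define f where "f n t = ennreal (indicator {0<..} t * (t / (t - s n)\<^sup>2))" for n t
  have mono: "t / (t - s m)\<^sup>2 \<le> t / (t - s n)\<^sup>2" if "t > 0" "m \<le> n" for t m n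
  proof -
    have "s m \<le> s n" using inc that by (simp add: incseq_def)
    then show ?thesis
      using that neg[of n] neg[of m] by (intro divide_left_mono power_mono mult_pos_pos zero_less_power) auto
  qed
  have "(\<lambda>n. integral\<^sup>N \<mu> (f n)) \<longlonglongrightarrow> (\<integral>\<^sup>+t. ennreal (indicator {0<..} t * (1 / t)) \<partial>\<mu>)"
  proof (rule nn_integral_LIMSEQ)
    show "incseq f"
      unfolding incseq_def le_fun_def f_def
      by (intro allI impI ennreal_leI) (auto simp: indicator_def intro: mono)
    show "f n \<in> borel_measurable \<mu>" for n
      unfolding f_def by measurable
    show "(\<lambda>n. f n t) \<longlonglongrightarrow> ennreal (indicator {0<..} t * (1 / t))" for t
    proof (cases "t > 0")
      case True
      then have "(\<lambda>n. t / (t - s n)\<^sup>2) \<longlonglongrightarrow> t / (t - 0)\<^sup>2"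
        by (intro tendsto_intros lim) auto
      then have "(\<lambda>n. ennreal (t / (t - s n)\<^sup>2)) \<longlonglongrightarrow> ennreal (t / (t - 0)\<^sup>2)"
        by (rule tendsto_ennrealI)
      then show ?thesis
        using True by (simp add: f_def power2_eq_square)
    qed (simp add: f_def)
  qed
  also have "(\<integral>\<^sup>+t. ennreal (indicator {0<..} t * (1 / t)) \<partial>\<mu>) = (\<integral>\<^sup>+t. ennreal (1 / t) \<partial>\<mu>)"
    by (intro nn_integral_cong) (simp add: space_eq)
  also have "(\<lambda>n. integral\<^sup>N \<mu> (f n)) = (\<lambda>n. \<integral>\<^sup>+t. ennreal (t / (t - s n)\<^sup>2) \<partial>\<mu>)"
    by (intro ext nn_integral_cong) (simp add: space_eq f_def)
  finally show ?thesis .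
qed

end

section \<open>The function \<phi> on the negative half-axis\<close>

locale complete_Bernstein = Stieltjes_measure \<mu> for \<mu> :: "real measure" +
  fixes \<phi> :: "complex \<Rightarrow> complex"
  assumes rep: "OM_minus_rep \<phi> \<mu>"
begin

lemma phi_eq: "z \<notin> complex_of_real ` {0<..} \<Longrightarrow> \<phi> z = (\<integral>t. z / (complex_of_real t - z) \<partial>\<mu>)"
  using rep by (simp add: OM_minus_rep_def)

lemma phi_nonpos:
  assumes "x \<le> 0"
  shows "\<phi> (complex_of_real x) = complex_of_real (\<integral>t. x / (t - x) \<partial>\<mu>)"
proof -
  have "\<phi> (complex_of_real x) = (\<integral>t. complex_of_real (x / (t - x)) \<partial>\<mu>)"
    using assms by (subst phi_eq) (auto simp flip: of_real_diff of_real_divide)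
  then show ?thesis by (simp only: integral_complex_of_real)
qed

lemma integrable_nonpos:
  assumes "x \<le> 0"
  shows "integrable \<mu> (\<lambda>t. x / (t - x))"
proof (cases "x = 0")
  case False
  then have "-x > 0" using assms by simp
  from integrable_shift[OF this, of x] show ?thesis by simp
qed simp

text \<open>Differentiation under the integral sign, carried out directly: the difference quotient
  minus the candidate derivative is the integral of t (z - S) / ((t - z) (t - S)^2), at most |z - S|
  times a constant for z near S. The increments are complex because \<open>deriv_minus_zero\<close>
  uses the complex derivative.\<close>

lemma has_field_derivative_neg:
  assumes s: "s < 0"
  shows "(\<phi> has_field_derivative complex_of_real (\<integral>t. t / (t - s)\<^sup>2 \<partial>\<mu>)) (at (complex_of_real s))"
    and "integrable \<mu> (\<lambda>t. t / (t - s)\<^sup>2)"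
proof -
  \<comment> \<open>Half the distance from s to 0: for z within r of s = -2 r the real part stays
    below -r, so |t - z| and |t - s| are both at least t + r.\<close>
  define r where "r = - s / 2"
  have r: "r > 0" and s_eq: "s = - 2 * r" using s by (simp_all add: r_def)
  have le1: "norm (t / (t - s)\<^sup>2) \<le> 1 / (t + r)" if t: "t > 0" for t
  proof -
    have "t * (t + r) \<le> (t - s)\<^sup>2"
      using t r by (simp add: s_eq power2_eq_square algebra_simps)
    then show ?thesis
      using t r by (simp add: divide_simps s_eq)
  qed
  show int: "integrable \<mu> (\<lambda>t. t / (t - s)\<^sup>2)"
    by (rule integrable_dominated[OF r _ le1]) measurable
  define D where "D = complex_of_real (\<integral>t. t / (t - s)\<^sup>2 \<partial>\<mu>)"
  define S where "S = complex_of_real s"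
  have D: "D = (\<integral>t. complex_of_real t / (complex_of_real t - S)\<^sup>2 \<partial>\<mu>)"
    unfolding D_def integral_complex_of_real[symmetric]
    by (simp add: S_def)
  have intD: "integrable \<mu> (\<lambda>t. complex_of_real t / (complex_of_real t - S)\<^sup>2)"
    using integrable_of_real[OF int, where 'a = complex] by (simp add: S_def)
  have S_le: "t + r \<le> cmod (complex_of_real t - S)" if "t > 0" for t
    using that r unfolding S_def of_real_diff[symmetric] norm_of_real by (simp add: s_eq)
  have meas[measurable]: "complex_of_real \<in> borel_measurable \<mu>"
    using measurable_ident by measurable
  \<comment> \<open>With both distances at least t + r, the kernel t / (|t - z| |t - S|^2) is at
    most t / (t + r)^3, and t r \<le> (t + r)^2 turns this into 1 / (r (t + r)), which is integrable
    and independent of z.\<close>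
  define K where "K = (\<integral>t. (1 / r) / (t + r) \<partial>\<mu>)"
  have bound: "norm ((\<phi> z - \<phi> S) / (z - S) - D) \<le> norm (z - S) * K"
    if z: "z \<noteq> S" "dist z S < r" for z
  proof -
    have "\<bar>Re (z - S)\<bar> < r"
      using abs_Re_le_cmod[of "z - S"] z by (simp add: dist_norm)
    then have Re: "Re z < - r"
      by (simp add: S_def s_eq)
    have z_notin: "z \<notin> complex_of_real ` {0<..}" and S_notin: "S \<notin> complex_of_real ` {0<..}"
      using Re r s by (auto simp: S_def)
    have z_le: "t + r \<le> cmod (complex_of_real t - z)" for t
      using complex_Re_le_cmod[of "complex_of_real t - z"] Re by simp
    have ne: "complex_of_real t - z \<noteq> 0" "complex_of_real t - S \<noteq> 0" if "t > 0" for t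
      using z_le[of t] S_le[OF that] that r by force+
    have int1: "integrable \<mu> (\<lambda>t. w / (complex_of_real t - w))"
      if w: "\<And>t. t > 0 \<Longrightarrow> t + r \<le> cmod (complex_of_real t - w)" for w
    proof (rule integrable_dominated[OF r])
      show "norm (w / (complex_of_real t - w)) \<le> cmod w / (t + r)" if "t > 0" for t
        unfolding norm_divide using \<open>t > 0\<close> r w[OF \<open>t > 0\<close>] by (intro divide_left_mono mult_pos_pos) auto
    qed measurable
    have "(\<phi> z - \<phi> S) / (z - S) - D = (\<integral>t. (z / (complex_of_real t - z) - S / (complex_of_real t - S)) / (z - S)
        - complex_of_real t / (complex_of_real t - S)\<^sup>2 \<partial>\<mu>)"
      unfolding phi_eq[OF z_notin] phi_eq[OF S_notin] D
      using int1[OF z_le] int1[OF S_le] intD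
      by (simp add: Bochner_Integration.integral_diff)
    also have "\<dots> = (\<integral>t. complex_of_real t * (z - S) / ((complex_of_real t - z) * (complex_of_real t - S)\<^sup>2) \<partial>\<mu>)"
    proof (intro Bochner_Integration.integral_cong refl)
      fix t assume "t \<in> space \<mu>"
      then have t: "t > 0" by (simp add: space_eq)
      have "(z / (T - z) - S / (T - S)) / d - T / (T - S)\<^sup>2 = T * d / ((T - z) * (T - S)\<^sup>2)"
        if "T - z \<noteq> 0" "T - S \<noteq> 0" "d \<noteq> 0" "d = z - S" for T d
      proof -
        have "(z / (T - z) - S / (T - S)) = T * d / ((T - z) * (T - S))"
          using that by (simp add: divide_simps) (simp add: algebra_simps)
        then have "(z / (T - z) - S / (T - S)) / d = T / ((T - z) * (T - S))"
          using that by simp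
        moreover have "T / ((T - z) * (T - S)) - T / (T - S)\<^sup>2 = T * d / ((T - z) * (T - S)\<^sup>2)"
          using that(1,2) unfolding that(4)
          by (simp add: divide_simps power2_eq_square) (simp add: algebra_simps)
        ultimately show ?thesis by simp
      qed
      from this[OF ne[OF t] _ refl] z(1)
      show "(z / (complex_of_real t - z) - S / (complex_of_real t - S)) / (z - S)
          - complex_of_real t / (complex_of_real t - S)\<^sup>2 =
          complex_of_real t * (z - S) / ((complex_of_real t - z) * (complex_of_real t - S)\<^sup>2)"
        by simp
    qed
    also have "norm \<dots> \<le> (\<integral>t. norm (z - S) * ((1 / r) / (t + r)) \<partial>\<mu>)"
    proof (rule Bochner_Integration.integral_norm_bound_integral)
      have le: "norm (complex_of_real t * (z - S) / ((complex_of_real t - z) * (complex_of_real t - S)\<^sup>2))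
          \<le> norm (z - S) * ((1 / r) / (t + r))" if t: "t > 0" for t
      proof -
        have "t * r \<le> (t + r) * (t + r)"
          using t r by (intro mult_mono) auto
        then have "t * (r * (t + r)) \<le> (t + r) * (t + r)\<^sup>2"
          using t r by (simp add: power2_eq_square mult.assoc[symmetric])
        also have "\<dots> \<le> cmod (complex_of_real t - z) * (cmod (complex_of_real t - S))\<^sup>2"
          using t r z_le[of t] S_le[OF t] by (intro mult_mono power_mono) auto
        finally have "t / (cmod (complex_of_real t - z) * (cmod (complex_of_real t - S))\<^sup>2) \<le> 1 / (r * (t + r))"
          using t r ne[OF t] by (simp add: divide_simps mult.commute)
        from mult_left_mono[OF this norm_ge_zero[of "z - S"]] show ?thesis
          using t by (simp add: norm_mult norm_divide norm_power mult.commute)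
      qed
      then show "norm (complex_of_real t * (z - S) / ((complex_of_real t - z) * (complex_of_real t - S)\<^sup>2))
          \<le> norm (z - S) * ((1 / r) / (t + r))" if "t \<in> space \<mu>" for t
        using that by (simp add: space_eq)
      show "integrable \<mu> (\<lambda>t. complex_of_real t * (z - S) / ((complex_of_real t - z) * (complex_of_real t - S)\<^sup>2))"
      proof (rule integrable_dominated[OF r])
        show "norm (complex_of_real t * (z - S) / ((complex_of_real t - z) * (complex_of_real t - S)\<^sup>2))
            \<le> norm (z - S) * (1 / r) / (t + r)" if "t > 0" for t
          using le[OF that] by simp
      qed measurable
      show "integrable \<mu> (\<lambda>t. norm (z - S) * ((1 / r) / (t + r)))"
        by (intro integrable_mult_right integrable_shift r)
    qed
    also have "\<dots> = norm (z - S) * K"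
      unfolding K_def by (rule integral_mult_right_zero)
    finally show ?thesis .
  qed
  have "((\<lambda>z. (\<phi> z - \<phi> S) / (z - S)) \<longlongrightarrow> D) (at S)"
  proof (rule LIM_zero_cancel, rule Lim_null_comparison)
    show "\<forall>\<^sub>F z in at S. norm ((\<phi> z - \<phi> S) / (z - S) - D) \<le> norm (z - S) * K"
      using r bound by (auto simp: eventually_at)
    show "((\<lambda>z. norm (z - S) * K) \<longlongrightarrow> 0) (at S)"
      by (auto intro!: tendsto_eq_intros)
  qed
  then show "(\<phi> has_field_derivative complex_of_real (\<integral>t. t / (t - s)\<^sup>2 \<partial>\<mu>)) (at (complex_of_real s))"
    by (simp add: has_field_derivative_iff D_def S_def)
qed

text \<open>Increasing sequences suffice for a left limit, and along them the derivatives are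
  nonnegative integrals that converge in [0,\<infinity>]. So the limit exists in every case,
  \<open>Lim\<close> denotes it, and finite and infinite values need no separate treatment.\<close>

lemma deriv_minus_zero_eq: "deriv_minus_zero \<phi> = enn2ereal (\<integral>\<^sup>+t. ennreal (1 / t) \<partial>\<mu>)"
proof -
  have "((\<lambda>s. ereal (Re (deriv \<phi> (complex_of_real s)))) \<longlongrightarrow> enn2ereal (\<integral>\<^sup>+t. ennreal (1 / t) \<partial>\<mu>)) (at_left 0)"
  proof (rule tendsto_at_left_sequentially[of "-1"])
    fix s :: "nat \<Rightarrow> real"
    assume s: "\<And>n. s n < 0" "incseq s" "s \<longlonglongrightarrow> 0"
    have "ereal (Re (deriv \<phi> (complex_of_real (s n)))) = enn2ereal (\<integral>\<^sup>+t. ennreal (t / (t - s n)\<^sup>2) \<partial>\<mu>)" for n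
    proof -
      have "(\<integral>t. t / (t - s n)\<^sup>2 \<partial>\<mu>) \<ge> 0"
        by (intro integral_nonneg_AE AE_I2) (simp add: space_eq)
      then show ?thesis
        using DERIV_imp_deriv[OF has_field_derivative_neg(1)[OF s(1)]]
        by (subst nn_integral_eq_integral[OF has_field_derivative_neg(2)[OF s(1)]])
          (auto simp: space_eq enn2ereal_ennreal)
    qed
    then show "(\<lambda>n. ereal (Re (deriv \<phi> (complex_of_real (s n))))) \<longlonglongrightarrow> enn2ereal (\<integral>\<^sup>+t. ennreal (1 / t) \<partial>\<mu>)"
      using nn_integral_reciprocal_LIMSEQ[OF s(2,1,3)] by simp
  qed simp
  then show ?thesis
    unfolding deriv_minus_zero_def by (intro tendsto_Lim) auto
qed

text \<open>Compare x with the point 0, where \<phi> vanishes.\<close>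

lemma linear_bound_if_Lipschitz:
  assumes "L-lipschitz_on {..0::real} (\<lambda>x. \<phi> (complex_of_real x))"
  shows "\<forall>x\<in>{..0}. cmod (\<phi> (complex_of_real x)) \<le> L * \<bar>x\<bar>"
  using lipschitz_onD[OF assms, of _ 0] phi_nonpos[of 0] by (simp add: dist_norm)

text \<open>The increment of x / (t - x) is t (x - y) / ((t - x) (t - y)), and both factors of the
  denominator are at least t on the nonpositive half-axis. Hence it is at most |x - y| / t.\<close>

lemma Lipschitz_if_finite:
  assumes fin: "(\<integral>\<^sup>+t. ennreal (1 / t) \<partial>\<mu>) < \<infinity>"
  shows "(\<integral>t. 1 / t \<partial>\<mu>)-lipschitz_on {..0::real} (\<lambda>x. \<phi> (complex_of_real x))"
proof (rule lipschitz_onI)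
  have int: "integrable \<mu> (\<lambda>t. 1 / t)"
    using fin by (intro integrableI_nonneg AE_I2) (auto simp: space_eq)
  fix x y :: real assume "x \<in> {..0}" "y \<in> {..0}"
  then have xy: "x \<le> 0" "y \<le> 0" by auto
  have "dist (\<phi> (complex_of_real x)) (\<phi> (complex_of_real y)) = norm (\<integral>t. x / (t - x) - y / (t - y) \<partial>\<mu>)"
    using xy by (simp add: phi_nonpos dist_norm Bochner_Integration.integral_diff integrable_nonpos
        flip: of_real_diff)
  also have "\<dots> \<le> (\<integral>t. dist x y * (1 / t) \<partial>\<mu>)"
  proof (rule Bochner_Integration.integral_norm_bound_integral)
    fix t assume "t \<in> space \<mu>"
    then have t: "t > 0" by (simp add: space_eq)
    have "x / (t - x) - y / (t - y) = t * (x - y) / ((t - x) * (t - y))"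
      using t xy by (simp add: divide_simps) (simp add: algebra_simps)
    then have "norm (x / (t - x) - y / (t - y)) = dist x y * (t / ((t - x) * (t - y)))"
      using t xy by (simp add: abs_mult dist_norm)
    also have "\<dots> \<le> dist x y * (1 / t)"
    proof (intro mult_left_mono)
      have "t * t \<le> (t - x) * (t - y)"
        using t xy by (intro mult_mono) auto
      then show "t / ((t - x) * (t - y)) \<le> 1 / t"
        using t xy by (simp add: divide_simps)
    qed simp
    finally show "norm (x / (t - x) - y / (t - y)) \<le> dist x y * (1 / t)" .
  qed (intro int integrable_mult_right Bochner_Integration.integrable_diff integrable_nonpos xy)+
  also have "\<dots> = (\<integral>t. 1 / t \<partial>\<mu>) * dist x y"
    by (simp only: integral_mult_right_zero mult.commute)
  finally show "dist (\<phi> (complex_of_real x)) (\<phi> (complex_of_real y)) \<le> (\<integral>t. 1 / t \<partial>\<mu>) * dist x y" .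
qed (auto intro!: integral_nonneg_AE simp: space_eq)

text \<open>For \<open>x < 0\<close> the integrand of \<open>\<phi> x / x\<close> dominates that of the derivative at \<open>x\<close>.\<close>

lemma finite_if_linear_bound:
  assumes bound: "\<And>x. x \<le> 0 \<Longrightarrow> cmod (\<phi> (complex_of_real x)) \<le> L * \<bar>x\<bar>"
  shows "(\<integral>\<^sup>+t. ennreal (1 / t) \<partial>\<mu>) < \<infinity>"
proof -
  define s where "s n = - (1 / real (Suc n))" for n
  have "(\<lambda>n. - (1 / real (Suc n))) \<longlonglongrightarrow> 0"
    using tendsto_minus[OF LIMSEQ_Suc[OF lim_1_over_n]] by simp
  then have s: "incseq s" "\<And>n. s n < 0" "s \<longlonglongrightarrow> 0"
    by (auto simp: s_def[abs_def] incseq_def divide_simps)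
  have "(\<integral>\<^sup>+t. ennreal (t / (t - s n)\<^sup>2) \<partial>\<mu>) \<le> ennreal L" for n
  proof -
    have "(\<integral>\<^sup>+t. ennreal (t / (t - s n)\<^sup>2) \<partial>\<mu>) \<le> (\<integral>\<^sup>+t. ennreal (1 / (t - s n)) \<partial>\<mu>)"
    proof (intro nn_integral_mono ennreal_leI)
      fix t assume "t \<in> space \<mu>"
      then show "t / (t - s n)\<^sup>2 \<le> 1 / (t - s n)"
        using s(2)[of n] by (simp add: space_eq divide_simps power2_eq_square)
    qed
    also have "\<dots> = ennreal (\<integral>t. 1 / (t - s n) \<partial>\<mu>)"
      using s(2)[of n] integrable_shift[of "- s n" 1]
      by (intro nn_integral_eq_integral AE_I2) (auto simp: space_eq)
    also have "(\<integral>t. 1 / (t - s n) \<partial>\<mu>) \<le> L"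
    proof -
      have "(\<integral>t. s n / (t - s n) \<partial>\<mu>) = s n * (\<integral>t. 1 / (t - s n) \<partial>\<mu>)"
        by (subst integral_mult_right_zero[symmetric]) simp
      then have "\<bar>s n * (\<integral>t. 1 / (t - s n) \<partial>\<mu>)\<bar> \<le> L * \<bar>s n\<bar>"
        using bound[of "s n"] s(2)[of n] by (simp add: phi_nonpos norm_mult abs_mult)
      then have "\<bar>\<integral>t. 1 / (t - s n) \<partial>\<mu>\<bar> \<le> L"
        using s(2)[of n] by (simp add: abs_mult mult.commute[of L])
      then show ?thesis by simp
    qed
    finally show ?thesis by (simp add: ennreal_leI)
  qed
  then have "(\<integral>\<^sup>+t. ennreal (1 / t) \<partial>\<mu>) \<le> ennreal L"
    by (intro LIMSEQ_le_const2[OF nn_integral_reciprocal_LIMSEQ[OF s]]) auto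
  then show ?thesis
    by (rule le_less_trans) simp
qed

end

section \<open>Multiples of the identity as test operators\<close>

text \<open>This is where X \<noteq> {0} matters: on the zero space every operator norm is 0, and
  the operator Lipschitz condition would carry no information about \<phi>.\<close>

lemma onorm_scaleR_ident:
  fixes v :: "'a::real_normed_vector"
  assumes "v \<noteq> 0"
  shows "onorm (\<lambda>x::'a. r *\<^sub>R x) = \<bar>r\<bar>"
proof (rule antisym)
  have "\<bar>r\<bar> * norm v \<le> onorm (\<lambda>x::'a. r *\<^sub>R x) * norm v"
    using onorm[OF bounded_linear_scaleR_right, of r v] by simp
  then show "\<bar>r\<bar> \<le> onorm (\<lambda>x::'a. r *\<^sub>R x)"
    using assms by simp
qed (auto intro: onorm_bound)

lemma scaleC_scaleR_commute: "a *\<^sub>C (r *\<^sub>R x) = r *\<^sub>R (a *\<^sub>C x)"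
  for x :: "'a::complex_normed_vector"
  by (simp add: linear_scale bounded_linear.linear bounded_linear_scaleC)

lemma bounded_clinear_scaleR: "bounded_clinear (\<lambda>x. r *\<^sub>R x)"
  by (simp add: bounded_clinear_def bounded_linear_scaleR_right scaleC_scaleR_commute)

lemma bounded_ext_scaleR: "bounded_ext UNIV (\<lambda>x. r *\<^sub>R x) = (\<lambda>x. r *\<^sub>R x)"
  by (intro bounded_ext_eqI bounded_clinear_scaleR) auto

definition scalar_op :: "real \<Rightarrow> 'a::real_vector rel" where
  "scalar_op r = {(x, y). y = r *\<^sub>R x}"

lemma op_apply_scalar_op[simp]: "op_apply (scalar_op r) x = r *\<^sub>R x"
  by (simp add: op_apply_def scalar_op_def)

lemma Domain_scalar_op[simp]: "Domain (scalar_op r) = UNIV"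
  by (auto simp: scalar_op_def)

context
  fixes r t :: real
  assumes r: "r \<le> 0" and t: "t > 0"
begin

lemma bij_scalar_op: "bij (\<lambda>x::'a::complex_normed_vector. complex_of_real t *\<^sub>C x - op_apply (scalar_op r) x)"
  using r t by (intro bij_betw_byWitness[where f' = "\<lambda>x. (1 / (t - r)) *\<^sub>R x"])
    (auto simp: scaleC_of_real simp flip: scaleR_diff_left diff_divide_distrib)

lemma resolvent_scalar_op:
  "resolvent (complex_of_real t) (scalar_op r) = (\<lambda>x::'a::complex_normed_vector. (1 / (t - r)) *\<^sub>R x)"
proof
  fix x :: 'a
  show "resolvent (complex_of_real t) (scalar_op r) x = (1 / (t - r)) *\<^sub>R x"
    using r t unfolding resolvent_def Domain_scalar_op
    by (intro inv_into_f_eq[OF bij_is_inj[OF bij_scalar_op]])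
      (auto simp: scaleC_of_real simp flip: scaleR_diff_left diff_divide_distrib)
qed

end

text \<open>The resolvent is multiplication by 1 / (t - r), and t / (t - r) \<le> 1 for r \<le> 0.
  The constant 1 is common to all these operators, so a single Lipschitz constant covers every x
  \<le> 0.\<close>

lemma scalar_op_in_NP_le:
  assumes r: "r \<le> 0"
  shows "(scalar_op r :: 'a::complex_banach rel) \<in> NP_le 1"
proof -
  let ?A = "scalar_op r :: 'a rel"
  have "closed {p :: 'a \<times> 'a. snd p = r *\<^sub>R fst p}"
    by (intro closed_Collect_eq continuous_intros)
  also have "{p :: 'a \<times> 'a. snd p = r *\<^sub>R fst p} = ?A"
    by (auto simp: scalar_op_def)
  finally have "closed ?A" .
  moreover have "linear_operator ?A"
    by (auto simp: linear_operator_def scalar_op_def single_valued_def scaleR_add_right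
        scaleC_scaleR_commute)
  moreover have "complex_of_real ` {0<..} \<subseteq> resolvent_set ?A"
    using r by (auto simp: resolvent_set_def bij_scalar_op[simplified] resolvent_scalar_op bounded_clinear_scaleR)
  moreover have le: "nonpos_const ?A \<le> ereal 1"
    unfolding nonpos_const_def
  proof (rule SUP_least)
    fix t :: real assume "t \<in> {0<..}"
    then show "ereal (onorm (\<lambda>x::'a. t *\<^sub>R resolvent (complex_of_real t) ?A x)) \<le> ereal 1"
      using r by (auto simp: resolvent_scalar_op pos_divide_le_eq right_diff_distrib mult_nonpos_nonneg
          mult.commute[of _ r] mult.commute[of t] intro!: onorm_bound)
  qed
  ultimately show ?thesis
    using le_less_trans[OF le, of \<infinity>] by (auto simp: NP_le_def NP_def)
qed

text \<open>The integrand A R(t,A) v is x / (t - x) times the fixed vector v, so the scalar integral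
  is carried over by the bounded linear map r \<mapsto> r v. By \<open>phi_nonpos\<close> the
  coefficient is \<phi>(x).\<close>

lemma (in complete_Bernstein) op_calc_scalar_op:
  assumes x: "x \<le> 0"
  shows "op_apply (op_calc \<mu> (scalar_op x)) v = (\<integral>t. x / (t - x) \<partial>\<mu>) *\<^sub>R (v :: 'a::complex_banach)"
proof -
  interpret operator_calculus "scalar_op x :: 'a rel" 1 \<mu>
    by unfold_locales (rule scalar_op_in_NP_le[OF x])
  have "has_Bochner_int \<mu> (\<lambda>t. x / (t - x)) (\<integral>t. x / (t - x) \<partial>\<mu>)"
    using integrable_nonpos[OF x]
    by (simp add: has_Bochner_int_iff_has_bochner_integral has_bochner_integral_integrable)
  from has_Bochner_int_bounded_linear[OF bounded_linear_scaleR_left this, of v]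
  have "has_Bochner_int \<mu> (\<lambda>t. op_apply (scalar_op x) (R t v)) ((\<integral>t. x / (t - x) \<partial>\<mu>) *\<^sub>R v)"
    by (subst (asm) has_Bochner_int_cong[where g = "\<lambda>t. op_apply (scalar_op x) (R t v)"])
      (simp_all add: space_eq resolvent_scalar_op x)
  then show ?thesis
    by (intro op_apply_op_calc) simp_all
qed

lemma (in complete_Bernstein) linear_bound_if_op_Lipschitz_NP:
  assumes nontrivial: "(UNIV :: 'a::complex_banach set) \<noteq> {0}"
    and lip: "op_Lipschitz_NP \<mu> TYPE('a)"
  shows "\<exists>L. \<forall>x\<in>{..0}. cmod (\<phi> (complex_of_real x)) \<le> L * \<bar>x\<bar>"
proof -
  obtain v :: 'a where v: "v \<noteq> 0"
    using nontrivial by auto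
  from lip obtain L where L: "\<And>A B :: 'a rel. A \<in> NP_le 1 \<Longrightarrow> B \<in> NP_le 1 \<Longrightarrow> Domain A \<subseteq> Domain B \<Longrightarrow>
      bounded_op_on (Domain A) (op_diff A B) \<Longrightarrow>
      onorm (bounded_ext (Domain A) (op_diff (op_calc \<mu> A) (op_calc \<mu> B)))
        \<le> L * onorm (bounded_ext (Domain A) (op_diff A B))"
    unfolding op_Lipschitz_NP_def by metis
  have "cmod (\<phi> (complex_of_real x)) \<le> L * \<bar>x\<bar>" if x: "x \<le> 0" for x
  proof -
    let ?A = "scalar_op x :: 'a rel" and ?B = "scalar_op 0 :: 'a rel"
    have diff: "op_diff ?A ?B = (\<lambda>u. x *\<^sub>R u)"
      by (simp add: op_diff_def fun_eq_iff)
    have calc: "op_diff (op_calc \<mu> ?A) (op_calc \<mu> ?B) = (\<lambda>u. (\<integral>t. x / (t - x) \<partial>\<mu>) *\<^sub>R u)"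
      using x by (simp add: op_diff_def op_calc_scalar_op fun_eq_iff)
    have "bounded_op_on UNIV (\<lambda>u::'a. x *\<^sub>R u)"
      unfolding bounded_op_on_def by (intro exI[of _ "\<bar>x\<bar>"]) simp
    then have "onorm (\<lambda>u::'a. (\<integral>t. x / (t - x) \<partial>\<mu>) *\<^sub>R u) \<le> L * onorm (\<lambda>u::'a. x *\<^sub>R u)"
      using L[of ?A ?B] x by (simp add: scalar_op_in_NP_le diff calc bounded_ext_scaleR)
    then show ?thesis
      using x by (simp add: onorm_scaleR_ident[OF v] phi_nonpos)
  qed
  then show ?thesis by auto
qed

theorem corollary3p2:
  fixes \<phi> :: "complex \<Rightarrow> complex" and \<mu> :: "real measure"
  assumes "(UNIV :: 'a::complex_banach set) \<noteq> {0}"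
    and "OM_minus_rep \<phi> \<mu>"
  shows "(op_Lipschitz_NP \<mu> TYPE('a) \<longleftrightarrow> deriv_minus_zero \<phi> \<noteq> \<infinity>) \<and>
         (deriv_minus_zero \<phi> \<noteq> \<infinity> \<longleftrightarrow> (\<integral>\<^sup>+t. ennreal (1 / t) \<partial>\<mu>) < \<infinity>) \<and>
         ((\<integral>\<^sup>+t. ennreal (1 / t) \<partial>\<mu>) < \<infinity> \<longleftrightarrow>
            (\<exists>L\<^sub>1::real. \<forall>x\<in>{..0::real}. cmod (\<phi> (complex_of_real x)) \<le> L\<^sub>1 * \<bar>x\<bar>)) \<and>
         ((\<exists>L\<^sub>1::real. \<forall>x\<in>{..0::real}. cmod (\<phi> (complex_of_real x)) \<le> L\<^sub>1 * \<bar>x\<bar>) \<longleftrightarrow>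
            (\<exists>L. L-lipschitz_on {..0::real} (\<lambda>x. \<phi> (complex_of_real x))))"
proof -
  interpret complete_Bernstein \<mu> \<phi>
    using assms(2) by unfold_locales (auto simp: OM_minus_rep_def)
  let ?fin = "(\<integral>\<^sup>+t. ennreal (1 / t) \<partial>\<mu>) < \<infinity>"
    and ?bound = "\<exists>L\<^sub>1::real. \<forall>x\<in>{..0::real}. cmod (\<phi> (complex_of_real x)) \<le> L\<^sub>1 * \<bar>x\<bar>"
    and ?lip = "\<exists>L. L-lipschitz_on {..0::real} (\<lambda>x. \<phi> (complex_of_real x))"
  \<comment> \<open>The implications form two cycles that share the step from \<open>?bound\<close>
    to \<open>?fin\<close>: one returns through the operator condition, the other through
    \<open>?lip\<close>. The derivative is attached to \<open>?fin\<close> by an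
    equivalence.\<close>
  have "op_Lipschitz_NP \<mu> TYPE('a) \<Longrightarrow> ?bound"
    by (rule linear_bound_if_op_Lipschitz_NP[OF assms(1)])
  moreover have "?bound \<Longrightarrow> ?fin"
    using finite_if_linear_bound by force
  moreover have "?fin \<Longrightarrow> op_Lipschitz_NP \<mu> TYPE('a)"
    by (rule op_Lipschitz_NP_if_finite)
  moreover have "?fin \<Longrightarrow> ?lip"
    using Lipschitz_if_finite by blast
  moreover have "?lip \<Longrightarrow> ?bound"
    using linear_bound_if_Lipschitz by blast
  moreover have "deriv_minus_zero \<phi> \<noteq> \<infinity> \<longleftrightarrow> ?fin"
    by (simp add: deriv_minus_zero_eq less_top)
  ultimately show ?thesis by argo
qed

end
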